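(* Let $\mathcal{G}=(\mathcal{V},\mathcal{E},A)$ be a weighted digraph with $n$ nodes that contains a directed spanning tree, and let $L$ be its graph Laplacian. Let $\Delta>0$ and let $q^s:\mathbb{R}\to\mathbb{R}$ be the symmetric uniform quantizer $q^s(z)=\big\lfloor \frac{z}{\Delta}+\frac12\big\rfloor\Delta$, applied componentwise to vectors: $q^s(x)=(q^s(x_1),\dots,q^s(x_n))^{\top}$. Then every complete Filippov solution $x:[0,\infty)\to\mathbb{R}^n$ of $$\dot x=-L\,q^s(x)$$ converges asymptotically, as $t\to\infty$, to practical consensus, i.e. to the set $$\mathcal{Q}=\Big\{x\in\mathbb{R}^n \;\Big|\; \exists k\in\mathbb{Z}\text{ such that } \big(k-\tfrac12\big)\Delta\le x_i\le\big(k+\tfrac12\big)\Delta\ \text{ for all } i=1,\dots,n\Big\}.$$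
   Context: Graph conventions: a weighted digraph $\mathcal{G}=(\mathcal{V},\mathcal{E},A)$ has node set $\mathcal{V}=\{v_1,\dots,v_n\}$, edge set $\mathcal{E}\subseteq\mathcal{V}\times\mathcal{V}$, and weighted adjacency matrix $A=[a_{ij}]\in\mathbb{R}^{n\times n}$ with $a_{ij}\ge 0$, $a_{ii}=0$, and $a_{ij}>0$ if and only if $(v_j,v_i)\in\mathcal{E}$ (an edge from $v_j$ to $v_i$). The Laplacian is $L=D-A$, where $D$ is diagonal with $D_{ii}=\sum_{j=1}^n a_{ij}$. A directed spanning tree of $\mathcal{G}$ is a weakly connected subgraph with node set $\mathcal{V}$ and $n-1$ edges from $\mathcal{E}$ in which every node has exactly one incoming edge, except one node (the root), which has none; equivalently, $\mathcal{G}$ contains a directed spanning tree if and only if some node has a directed path to every other node. Filippov solutions: for a map $X:\mathbb{R}^n\to\mathbb{R}^n$, $\mathcal{F}[X](x)=\bigcap_{\delta>0}\bigcap_{\mu(S)=0}\overline{\mathrm{co}}\{X(B(x,\delta)\setminus S)\}$, where $\mu$ is Lebesgue measure, $B(x,\delta)$ is the open ball, and $\overline{\mathrm{co}}$ is the closed convex hull. A Filippov solution of $\dot x=X(x)$ on an interval is a (locally) absolutely continuous function $x$ with $\dot x(t)\in\mathcal{F}[X](x(t))$ for almost every $t$ in that interval; it is complete if defined on $[0,\infty)$. A solution converges asymptotically to a set $D$ if $\inf_{y\in D}\|x(t)-y\|\to 0$ as $t\to\infty$. *)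

theory Defs
  imports "HOL-Analysis.Analysis" "Graph_Theory.Digraph_Component"
begin

text \<open>
  The nodes are the elements of the finite type \<open>'n\<close>. An entry \<open>A $ i $ j\<close> is the weight of the
  edge from \<open>j\<close> to \<open>i\<close>, so row and column are swapped relative to the pairs in \<open>E\<close>.
\<close>

definition weighted_digraph :: "('n \<times> 'n) set \<Rightarrow> real^'n^'n \<Rightarrow> bool" where
  "weighted_digraph E A \<longleftrightarrow>
     (\<forall>i j. 0 \<le> A $ i $ j) \<and> (\<forall>i. A $ i $ i = 0) \<and> (\<forall>i j. 0 < A $ i $ j \<longleftrightarrow> (j, i) \<in> E)"

definition digraph_of :: "('n \<times> 'n) set \<Rightarrow> ('n, 'n \<times> 'n) pre_digraph" where
  "digraph_of E = \<lparr>verts = UNIV, arcs = E, tail = fst, head = snd\<rparr>"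

definition laplacian :: "real^'n^'n \<Rightarrow> real^'n^'n" where
  "laplacian A = (\<chi> i j. if i = j then \<Sum>k\<in>UNIV. A $ i $ k else 0) - A"

text \<open>
  \<open>Digraph_Component.connected\<close> is connectedness of the symmetric closure, that is, weak
  connectedness; the qualifier separates it from the topological \<open>connected\<close>.
\<close>

definition directed_spanning_tree :: "('a, 'b) pre_digraph \<Rightarrow> ('a, 'b) pre_digraph \<Rightarrow> bool" where
  "directed_spanning_tree T G \<longleftrightarrow>
     spanning T G \<and> Digraph_Component.connected T \<and> card (arcs T) = card (verts G) - 1 \<and>
     (\<exists>r\<in>verts G. in_degree T r = 0 \<and> (\<forall>v\<in>verts G - {r}. in_degree T v = 1))"

definition sym_quantizer :: "real \<Rightarrow> real \<Rightarrow> real" where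
  "sym_quantizer \<Delta> z = of_int \<lfloor>z / \<Delta> + 1 / 2\<rfloor> * \<Delta>"

definition sym_quantizer_vec :: "real \<Rightarrow> real^'n \<Rightarrow> real^'n" where
  "sym_quantizer_vec \<Delta> x = (\<chi> i. sym_quantizer \<Delta> (x $ i))"

definition filippov :: "('a::euclidean_space \<Rightarrow> 'a) \<Rightarrow> 'a \<Rightarrow> 'a set" where
  "filippov X x =
     (\<Inter>\<delta>\<in>{0<..}. \<Inter>S\<in>null_sets lebesgue. closure (convex hull (X ` (ball x \<delta> - S))))"

text \<open>
  A family \<open>D\<close> with \<open>D division_of \<Union>D\<close> is a finite family of non-overlapping compact intervals;
  the interval \<open>k = {a..b}\<close> has \<open>Inf k = a\<close> and \<open>Sup k = b\<close>.
\<close>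

definition abs_continuous_on :: "real set \<Rightarrow> (real \<Rightarrow> 'a::real_normed_vector) \<Rightarrow> bool" where
  "abs_continuous_on I f \<longleftrightarrow>
     (\<forall>\<epsilon>>0. \<exists>\<delta>>0. \<forall>D. D division_of \<Union>D \<and> \<Union>D \<subseteq> I \<and> (\<Sum>k\<in>D. Sup k - Inf k) < \<delta> \<longrightarrow>
        (\<Sum>k\<in>D. norm (f (Sup k) - f (Inf k))) < \<epsilon>)"

definition locally_abs_continuous_on :: "real set \<Rightarrow> (real \<Rightarrow> 'a::real_normed_vector) \<Rightarrow> bool" where
  "locally_abs_continuous_on I f \<longleftrightarrow> (\<forall>a b. {a..b} \<subseteq> I \<longrightarrow> abs_continuous_on {a..b} f)"

definition filippov_solution_on ::
    "real set \<Rightarrow> ('a::euclidean_space \<Rightarrow> 'a) \<Rightarrow> (real \<Rightarrow> 'a) \<Rightarrow> bool" where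
  "filippov_solution_on I X x \<longleftrightarrow>
     is_interval I \<and> locally_abs_continuous_on I x \<and>
     (AE t in lebesgue. t \<in> I \<longrightarrow>
        (\<exists>v\<in>filippov X (x t). (x has_vector_derivative v) (at t within I)))"

abbreviation complete_filippov_solution ::
    "('a::euclidean_space \<Rightarrow> 'a) \<Rightarrow> (real \<Rightarrow> 'a) \<Rightarrow> bool" where
  "complete_filippov_solution \<equiv> filippov_solution_on {0..}"

text \<open>
  For nonempty \<open>D\<close>, \<open>infdist p D\<close> is the infimum of the distances from \<open>p\<close> to the points of \<open>D\<close>.
\<close>

definition converges_to_set :: "(real \<Rightarrow> 'a::metric_space) \<Rightarrow> 'a set \<Rightarrow> bool" where
  "converges_to_set x D \<longleftrightarrow> D \<noteq> {} \<and> ((\<lambda>t. infdist (x t) D) \<longlongrightarrow> 0) at_top"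

definition practical_consensus :: "real \<Rightarrow> (real^'n) set" where
  "practical_consensus \<Delta> =
     {x. \<exists>k::int. \<forall>i. (of_int k - 1 / 2) * \<Delta> \<le> x $ i \<and> x $ i \<le> (of_int k + 1 / 2) * \<Delta>}"

end

theory Submission
  imports Defs "HOL-Complex_Analysis.Great_Picard"
begin

text \<open>
  Every velocity of a Filippov solution at a point \<open>x\<close> has the form \<open>- L w\<close>, where \<open>w\<^sub>i\<close> lies between
  the left and the right limit of the quantizer at \<open>x\<^sub>i\<close>; in coordinates it is
  \<open>\<Sum>\<^sub>j a\<^sub>i\<^sub>j (w\<^sub>j - w\<^sub>i)\<close>. A node at which \<open>x\<close> and \<open>w\<close> are both largest cannot move up, so the largest
  coordinate is nonincreasing and, by the symmetry \<open>x \<mapsto> - x\<close>, the smallest is nondecreasing. Let \<open>M\<close>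
  and \<open>m\<close> be their limits. The theorem says that \<open>M\<close> and \<open>m\<close> lie in one closed quantization cell.

  Write \<open>(l - 1/2) \<Delta> < M \<le> (l + 1/2) \<Delta>\<close> and \<open>b = (l - 1/2) \<Delta>\<close>, and let \<open>r\<close> be the root of the spanning
  tree. The argument is of LaSalle type: along limits of time translates of a solution, every quantity
  that was monotone has become constant. It is enough to find a limit, one time and one \<open>w\<close>
  at which \<open>w\<^sub>r \<ge> l \<Delta>\<close>; the mirrored statement for \<open>m\<close>, at the same time and for the same \<open>w\<close>, then
  compares the two levels through the single number \<open>w\<^sub>r\<close> (\<open>limits_in_common_cell\<close>).

  If \<open>M\<close> were interior to its cell, all \<open>w\<^sub>j\<close> would eventually be at most \<open>l \<Delta>\<close>. The difficulty is a
  limit \<open>M\<close> on the border, where nodes sitting at \<open>M\<close> may use any value between \<open>l \<Delta>\<close> and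
  \<open>(l + 1) \<Delta>\<close> and may thereby push other nodes upwards. Three successive limits resolve it. In the first, the
  largest coordinate is constantly \<open>M\<close>, so nodes at \<open>M\<close> are at rest for almost every time. If some
  \<open>w\<^sub>j\<close> exceeds \<open>l \<Delta>\<close>, the nodes with the largest \<open>w\<close> are at \<open>M\<close>, hence at rest, hence have all
  their in-neighbours among themselves; so \<open>r\<close> is one of them and sits at \<open>M\<close>
  (\<open>root_at_top_or_values_bounded\<close>). In either case \<open>max x\<^sub>r b\<close> does not increase, and in the second limit it
  is constant. Then either the root stays at \<open>M\<close> forever, which gives \<open>w\<^sub>r \<ge> l \<Delta>\<close>, or it is never at
  \<open>M\<close>, all values are at most \<open>l \<Delta>\<close>, and all the truncations \<open>max x\<^sub>i b\<close> are nonincreasing. In the third limit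
  these are constant too, so every node with \<open>w\<^sub>i = l \<Delta>\<close> is at rest, the set of these nodes
  is closed under in-neighbours, and it contains \<open>r\<close> (\<open>iterated_limit_root_value\<close>).

  Derivatives do not pass to limits, and a limit of solutions is a priori only Lipschitz. The set-valued
  map \<open>x \<mapsto> {- L w}\<close> has compact convex values and near \<open>x\<close> its values are contained in the value at \<open>x\<close>.
  The dynamics can therefore be stated through difference quotients (\<open>trajectory\<close>), a condition that solutions
  satisfy (\<open>filippov_solution_imp_trajectory\<close>) and that limits inherit (\<open>limit_trajectory\<close>). What remains
  of almost everywhere differentiability is that a Lipschitz function is flat at almost every one of its zeros
  (\<open>lipschitz_zero_set_flat\<close>). Applied to differences of coordinates, it makes coordinates that meet move with the
  same velocity, and this turns the pointwise sign conditions into monotonicity (\<open>level_not_crossed\<close>).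
\<close>

section \<open>Absolutely continuous and monotone functions\<close>

text \<open>
  The conclusion of the fundamental theorem of calculus under a one-sided bound that does not ask for
  derivatives. Tag a fine division of \<open>{a..b}\<close>: cells tagged at a good point contribute at most \<open>e\<close> times
  their length, and cells tagged in the exceptional null set lie in an open set of small measure, where
  absolute continuity bounds their total contribution.
\<close>

lemma abs_continuous_on_nonincreasing:
  fixes f :: "real \<Rightarrow> real"
  assumes ac: "abs_continuous_on {a..b} f" and ab: "a \<le> b"
    and ae: "AE t in lebesgue. t \<in> {a..b} \<longrightarrow>
      (\<forall>e>0. \<exists>d>0. \<forall>u v. a \<le> u \<and> u \<le> t \<and> t \<le> v \<and> v \<le> b \<and> v - u < d \<longrightarrow> f v - f u \<le> e * (v - u))"
  shows "f b \<le> f a"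
proof (rule field_le_epsilon)
  fix e0 :: real assume "0 < e0"
  define e where "e = e0 / (b - a + 1)"
  have "0 < e" using \<open>0 < e0\<close> ab by (simp add: e_def)
  let ?good = "\<lambda>t. \<forall>e>0. \<exists>d>0. \<forall>u v. a \<le> u \<and> u \<le> t \<and> t \<le> v \<and> v \<le> b \<and> v - u < d \<longrightarrow> f v - f u \<le> e * (v - u)"
  have "\<exists>\<delta>>0. \<forall>D. D division_of \<Union>D \<and> \<Union>D \<subseteq> {a..b} \<and> (\<Sum>k\<in>D. Sup k - Inf k) < \<delta> \<longrightarrow>
        (\<Sum>k\<in>D. norm (f (Sup k) - f (Inf k))) < e"
    using ac \<open>0 < e\<close> unfolding abs_continuous_on_def by simp
  then obtain \<delta> where "0 < \<delta>" and \<delta>: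
    "\<And>D. D division_of \<Union>D \<Longrightarrow> \<Union>D \<subseteq> {a..b} \<Longrightarrow> (\<Sum>k\<in>D. Sup k - Inf k) < \<delta> \<Longrightarrow>
        (\<Sum>k\<in>D. norm (f (Sup k) - f (Inf k))) < e"
    by auto
  define N where "N = {t\<in>{a..b}. \<not> ?good t}"
  from ae obtain N0 where N0: "{t\<in>space lebesgue. \<not> (t \<in> {a..b} \<longrightarrow> ?good t)} \<subseteq> N0" "emeasure lebesgue N0 = 0" "N0 \<in> sets lebesgue"
    by (rule AE_E)
  have Nneg: "negligible N"
  proof (rule negligible_subset)
    show "negligible N0" using N0 by (simp add: negligible_iff_null_sets null_sets_def)
    show "N \<subseteq> N0" using N0(1) by (auto simp: N_def)
  qed
  then have "N \<in> null_sets lebesgue" by (simp add: negligible_iff_null_sets)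
  obtain U where "open U" "N \<subseteq> U" "U - N \<in> lmeasurable" "emeasure lebesgue (U - N) < ennreal \<delta>"
    using sets_lebesgue_outer_open[of N \<delta>] \<open>0 < \<delta>\<close> \<open>N \<in> null_sets lebesgue\<close> by blast
  have Um: "U \<in> lmeasurable" 
    using \<open>U - N \<in> lmeasurable\<close> Nneg \<open>N \<subseteq> U\<close> 
    by (metis Un_Diff_cancel2 fmeasurable.Un negligible_imp_measurable sup.absorb1)
  have UN: "measure lebesgue U < \<delta>"
  proof -
    have "measure lebesgue U = measure lebesgue (U - N)"
      using measure_Diff_null_set[of U lebesgue N] \<open>N \<in> null_sets lebesgue\<close> Um by (simp add: fmeasurableD)
    also have "\<dots> < \<delta>"
      using \<open>emeasure lebesgue (U - N) < ennreal \<delta>\<close> \<open>U - N \<in> lmeasurable\<close> \<open>0 < \<delta>\<close>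
      by (simp add: emeasure_eq_measure2 ennreal_less_iff)
    finally show ?thesis .
  qed
  have "\<exists>d>0. \<forall>u v. a \<le> u \<and> u \<le> t \<and> t \<le> v \<and> v \<le> b \<and> v - u < d \<longrightarrow> f v - f u \<le> e * (v - u)"
    if "t \<in> {a..b} - N" for t
    using that \<open>0 < e\<close> unfolding N_def by blast
  then obtain d where d: "\<And>t. t \<in> {a..b} - N \<Longrightarrow> 0 < d t"
    "\<And>t u v. t \<in> {a..b} - N \<Longrightarrow> a \<le> u \<Longrightarrow> u \<le> t \<Longrightarrow> t \<le> v \<Longrightarrow> v \<le> b \<Longrightarrow> v - u < d t \<Longrightarrow> f v - f u \<le> e * (v - u)"
    by metis
  define \<gamma> where "\<gamma> t = (if t \<in> N then U else if t \<in> {a..b} then ball t (d t / 2) else ball t 1)" for t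
  have "gauge \<gamma>"
    unfolding gauge_def \<gamma>_def using \<open>open U\<close> \<open>N \<subseteq> U\<close> d(1) by auto
  then obtain p where p: "p tagged_division_of {a..b}" "\<gamma> fine p"
    using fine_division_exists_real by blast
  define g where "g = (\<lambda>k::real set. f (Sup k) - f (Inf k))"
  have finp: "finite p" using p by auto
  define p1 where "p1 = {xk\<in>p. fst xk \<in> N}"
  have p1: "p1 tagged_partial_division_of {a..b}"
  proof (rule tagged_partial_division_subset)
    show "p tagged_partial_division_of {a..b}" using p(1) unfolding tagged_division_of_def by (rule conjunct1)
  qed (auto simp: p1_def)
  have iv: "\<exists>u v. k = {u..v} \<and> u \<le> v \<and> a \<le> u \<and> v \<le> b \<and> u \<le> x \<and> x \<le> v \<and> k \<subseteq> \<gamma> x" if "(x,k) \<in> p" for x k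
  proof -
    have "x \<in> k" "k \<subseteq> {a..b}" "\<exists>u v. k = cbox u v"
      using tagged_division_ofD(2,3,4)[OF p(1) that] by auto
    then obtain u v where k: "k = {u..v}" by auto
    moreover have "k \<subseteq> \<gamma> x" using p(2) that by (rule fineD)
    moreover have "a \<le> u" "v \<le> b" "u \<le> x" "x \<le> v"
      using \<open>x \<in> k\<close> \<open>k \<subseteq> {a..b}\<close> by (auto simp: k)
    ultimately show ?thesis by (intro exI[of _ u] exI[of _ v]) auto
  qed
  have "f b - f a = (\<Sum>(x,k)\<in>p. g k)"
    using additive_tagged_division_1[OF ab p(1), of f] by (simp add: g_def)
  also have "\<dots> = (\<Sum>(x,k)\<in>p1. g k) + (\<Sum>(x,k)\<in>p - p1. g k)"
    using finp by (subst sum.subset_diff[of p1 p]) (auto simp: p1_def)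
  also have "(\<Sum>(x,k)\<in>p - p1. g k) \<le> (\<Sum>(x,k)\<in>p - p1. e * measure lborel k)"
  proof (rule sum_mono, clarify)
    fix x k assume xk: "(x,k) \<in> p" "(x,k) \<notin> p1"
    obtain u v where uv: "k = {u..v}" "u \<le> v" "a \<le> u" "v \<le> b" "u \<le> x" "x \<le> v" "k \<subseteq> \<gamma> x"
      using iv[OF xk(1)] by (elim exE conjE) (rule that)
    have x: "x \<in> {a..b} - N" using xk uv by (auto simp: p1_def)
    then have "{u..v} \<subseteq> ball x (d x / 2)" using uv by (auto simp: \<gamma>_def)
    then have "u \<in> ball x (d x / 2)" "v \<in> ball x (d x / 2)" using \<open>u \<le> v\<close> by auto
    then have "\<bar>x - u\<bar> < d x / 2" "\<bar>x - v\<bar> < d x / 2" by (simp_all add: dist_real_def)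
    then have "v - u < d x" by linarith
    then show "g k \<le> e * measure lborel k" using d(2)[OF x, of u v] uv by (simp add: g_def)
  qed
  also have "\<dots> \<le> (\<Sum>(x,k)\<in>p. e * measure lborel k)"
    using finp \<open>0 < e\<close> by (intro sum_mono2) auto
  also have "\<dots> = e * (b - a)"
    using additive_content_tagged_division[of p a b] p(1) ab 
    by (simp add: sum_distrib_left[symmetric] case_prod_unfold)
  \<comment> \<open>A cell may occur with several tags, but then it is degenerate and contributes nothing.\<close>
  also have "(\<Sum>(x,k)\<in>p1. g k) = (\<Sum>k\<in>snd ` p1. g k)"
  proof -
    have "(\<Sum>k\<in>snd ` p1. g k) = (\<Sum>xk\<in>p1. g (snd xk))"
    proof (rule sum.reindex_nontrivial[of p1 snd g, unfolded o_def])
      show "finite p1" using finp by (simp add: p1_def)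
      fix s t assume st: "s \<in> p1" "t \<in> p1" "s \<noteq> t" "snd s = snd t"
      obtain x k y l where [simp]: "s = (x,k)" "t = (y,l)" by fastforce
      have "k = l" "interior k \<inter> interior l = {}"
        using st tagged_partial_division_ofD(5)[OF p1, of x k y l] by auto
      moreover obtain u v where "k = {u..v}" "u \<le> v" using iv[of x k] st by (auto simp: p1_def)
      ultimately have "{u<..<v} = {}" using interior_atLeastAtMost_real[of u v] by simp
      then have "u = v" using \<open>u \<le> v\<close> by auto
      then show "g (snd s) = 0" using \<open>k = {u..v}\<close> by (simp add: g_def)
    qed
    then show ?thesis by (simp add: case_prod_unfold)
  qed
  also have "\<dots> \<le> (\<Sum>k\<in>snd ` p1. norm (f (Sup k) - f (Inf k)))"
    unfolding g_def by (intro sum_mono) auto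
  also have "\<dots> < e"
  proof (rule \<delta>)
    let ?D = "snd ` p1"
    show div: "?D division_of \<Union>?D" using partial_division_of_tagged_division[OF p1] .
    show "\<Union>?D \<subseteq> {a..b}" using iv by (fastforce simp: p1_def)
    have "(\<Sum>k\<in>?D. Sup k - Inf k) = (\<Sum>k\<in>?D. measure lebesgue k)"
    proof (rule sum.cong[OF refl])
      fix k assume "k \<in> ?D"
      then obtain x where "(x,k) \<in> p" by (auto simp: p1_def)
      then obtain u v where "k = {u..v}" "u \<le> v" using iv by blast
      then show "Sup k - Inf k = measure lebesgue k" by simp
    qed
    also have "\<dots> = measure lebesgue (\<Union>?D)" using content_division[OF div] .
    also have "\<dots> \<le> measure lebesgue U"
    proof (rule measure_mono_fmeasurable)
      show "\<Union>?D \<subseteq> U" using iv by (fastforce simp: p1_def \<gamma>_def)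
      show "\<Union>?D \<in> sets lebesgue" using div by (metis fmeasurableD lmeasurable_division)
    qed (rule Um)
    finally show "(\<Sum>k\<in>?D. Sup k - Inf k) < \<delta>" using UN by simp
  qed
  finally have "f b - f a < e * (b - a + 1)" by (simp add: algebra_simps)
  also have "\<dots> = e0" using ab by (simp add: e_def)
  finally show "f b \<le> f a + e0" by simp
qed

lemma abs_continuous_on_dominated:
  fixes x :: "real \<Rightarrow> 'a::real_normed_vector" and f :: "real \<Rightarrow> 'b::real_normed_vector"
  assumes ac: "abs_continuous_on {a..b} x" and "0 \<le> C"
    and dom: "\<And>u v. u \<in> {a..b} \<Longrightarrow> v \<in> {a..b} \<Longrightarrow> norm (f v - f u) \<le> C * (norm (x v - x u) + \<bar>v - u\<bar>)"
  shows "abs_continuous_on {a..b} f"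
  unfolding abs_continuous_on_def
proof (intro allI impI)
  fix e :: real assume "0 < e"
  \<comment> \<open>The added 1 keeps the denominator positive when \<open>C\<close> is 0.\<close>
  define e' where "e' = e / (2 * (C + 1))"
  have "0 < e'" using \<open>0 < e\<close> \<open>0 \<le> C\<close> by (simp add: e'_def)
  have "\<exists>\<delta>>0. \<forall>D. D division_of \<Union>D \<and> \<Union>D \<subseteq> {a..b} \<and> (\<Sum>k\<in>D. Sup k - Inf k) < \<delta> \<longrightarrow>
        (\<Sum>k\<in>D. norm (x (Sup k) - x (Inf k))) < e'"
    using ac \<open>0 < e'\<close> unfolding abs_continuous_on_def by simp
  then obtain \<delta> where "0 < \<delta>" and \<delta>:
    "\<And>D. D division_of \<Union>D \<Longrightarrow> \<Union>D \<subseteq> {a..b} \<Longrightarrow> (\<Sum>k\<in>D. Sup k - Inf k) < \<delta> \<Longrightarrow>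
        (\<Sum>k\<in>D. norm (x (Sup k) - x (Inf k))) < e'"
    by auto
  have "(\<Sum>k\<in>D. norm (f (Sup k) - f (Inf k))) < e"
    if D: "D division_of \<Union>D" "\<Union>D \<subseteq> {a..b}" "(\<Sum>k\<in>D. Sup k - Inf k) < min \<delta> e'" for D
  proof -
    have "norm (f (Sup k) - f (Inf k)) \<le> C * (norm (x (Sup k) - x (Inf k)) + (Sup k - Inf k))" if "k \<in> D" for k
    proof -
      have "k \<noteq> {}" "\<exists>u v. k = cbox u v" "k \<subseteq> {a..b}"
        using division_ofD(3,4)[OF D(1) that] D(2) that by auto
      then obtain u v where k: "k = {u..v}" "u \<le> v" by auto
      then have "u \<in> {a..b}" "v \<in> {a..b}" using \<open>k \<subseteq> {a..b}\<close> by auto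
      then show ?thesis using dom[of u v] k by simp
    qed
    then have "(\<Sum>k\<in>D. norm (f (Sup k) - f (Inf k)))
      \<le> (\<Sum>k\<in>D. C * (norm (x (Sup k) - x (Inf k)) + (Sup k - Inf k)))"
      by (rule sum_mono)
    also have "\<dots> = C * ((\<Sum>k\<in>D. norm (x (Sup k) - x (Inf k))) + (\<Sum>k\<in>D. Sup k - Inf k))"
      unfolding sum.distrib[symmetric] sum_distrib_left ..
    also have "\<dots> \<le> C * (e' + e')"
      using \<delta>[OF D(1,2)] D(3) \<open>0 \<le> C\<close> by (intro mult_left_mono) auto
    also have "\<dots> < (C + 1) * (e' + e')" using \<open>0 < e'\<close> by simp
    also have "\<dots> = e' * (2 * (C + 1))" by (simp add: algebra_simps)
    also have "\<dots> = e" using \<open>0 \<le> C\<close> by (simp add: e'_def)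
    finally show ?thesis .
  qed
  then show "\<exists>\<delta>>0. \<forall>D. D division_of \<Union>D \<and> \<Union>D \<subseteq> {a..b} \<and> (\<Sum>k\<in>D. Sup k - Inf k) < \<delta> \<longrightarrow>
      (\<Sum>k\<in>D. norm (f (Sup k) - f (Inf k))) < e"
    using \<open>0 < \<delta>\<close> \<open>0 < e'\<close> by (intro exI[of _ "min \<delta> e'"]) simp
qed

lemma lipschitz_imp_abs_continuous_on:
  fixes f :: "real \<Rightarrow> 'b::real_normed_vector"
  assumes "L-lipschitz_on {a..b} f"
  shows "abs_continuous_on {a..b} f"
proof (rule abs_continuous_on_dominated)
  show "abs_continuous_on {a..b} (\<lambda>_. 0::real)"
    unfolding abs_continuous_on_def by (auto intro: exI[of _ 1])
  show "0 \<le> L" using assms lipschitz_on_nonneg by blast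
  show "norm (f v - f u) \<le> L * (norm ((0::real) - 0) + \<bar>v - u\<bar>)" if "u \<in> {a..b}" "v \<in> {a..b}" for u v
    using lipschitz_onD[OF assms that(2,1)] by (simp add: dist_norm)
qed

text \<open>
  A mean value theorem: if the mean velocity lay outside \<open>C\<close>, a hyperplane would separate the two, and
  the corresponding linear functional of \<open>x\<close>, corrected by its threshold slope, would contradict
  \<open>abs_continuous_on_nonincreasing\<close>.
\<close>

lemma abs_continuous_increment_in_convex:
  fixes x :: "real \<Rightarrow> 'a::euclidean_space"
  assumes ac: "abs_continuous_on {a..b} x" and ab: "a \<le> b"
    and C: "convex C" "closed C" "C \<noteq> {}"
    and ae: "AE t in lebesgue. t \<in> {a..b} \<longrightarrow> (\<exists>v\<in>C. (x has_vector_derivative v) (at t within {a..b}))"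
  shows "\<exists>c\<in>C. x b - x a = (b - a) *\<^sub>R c"
proof (cases "a = b")
  case True
  then show ?thesis using C(3) by auto
next
  case False
  then have "a < b" using ab by simp
  define q where "q = (x b - x a) /\<^sub>R (b - a)"
  have q: "x b - x a = (b - a) *\<^sub>R q" using \<open>a < b\<close> by (simp add: q_def)
  have "q \<in> C"
  proof (rule ccontr)
    assume "q \<notin> C"
    then obtain p \<beta> where p: "p \<bullet> q < \<beta>" "\<And>c. c \<in> C \<Longrightarrow> \<beta> < p \<bullet> c"
      using separating_hyperplane_closed_point[OF C(1,2)] by blast
    define f where "f t = \<beta> * t - p \<bullet> x t" for t
    have "f b \<le> f a"
    proof (rule abs_continuous_on_nonincreasing[OF _ ab])
      show "abs_continuous_on {a..b} f"
      proof (rule abs_continuous_on_dominated[OF ac])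
        show "0 \<le> norm p + \<bar>\<beta>\<bar>" by simp
        fix u v
        have "f v - f u = \<beta> * (v - u) - p \<bullet> (x v - x u)" by (simp add: f_def algebra_simps inner_diff_right)
        then have "norm (f v - f u) \<le> \<bar>\<beta>\<bar> * \<bar>v - u\<bar> + norm p * norm (x v - x u)"
          using Cauchy_Schwarz_ineq2[of p "x v - x u"] abs_triangle_ineq4[of "\<beta> * (v - u)" "p \<bullet> (x v - x u)"]
          by (simp add: abs_mult)
        also have "\<dots> \<le> (norm p + \<bar>\<beta>\<bar>) * (norm (x v - x u) + \<bar>v - u\<bar>)"
          by (simp add: algebra_simps)
        finally show "norm (f v - f u) \<le> (norm p + \<bar>\<beta>\<bar>) * (norm (x v - x u) + \<bar>v - u\<bar>)" .
      qed
      show "AE t in lebesgue. t \<in> {a..b} \<longrightarrow>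
        (\<forall>e>0. \<exists>d>0. \<forall>u v. a \<le> u \<and> u \<le> t \<and> t \<le> v \<and> v \<le> b \<and> v - u < d \<longrightarrow> f v - f u \<le> e * (v - u))"
        using ae
      proof (rule AE_mp, intro AE_I2 impI allI)
        fix t e :: real
        assume "t \<in> {a..b} \<longrightarrow> (\<exists>v\<in>C. (x has_vector_derivative v) (at t within {a..b}))" "t \<in> {a..b}" "0 < e"
        then obtain c where "c \<in> C" and c: "(x has_vector_derivative c) (at t within {a..b})" by blast
        have D: "\<beta> - p \<bullet> c \<le> 0" using p(2)[OF \<open>c \<in> C\<close>] by simp
        have "((\<lambda>t. p \<bullet> x t) has_vector_derivative (p \<bullet> c)) (at t within {a..b})"
          using bounded_linear.has_vector_derivative[OF bounded_linear_inner_right c] .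
        moreover have "((\<lambda>t. \<beta> * t) has_vector_derivative \<beta>) (at t within {a..b})"
          unfolding has_real_derivative_iff_has_vector_derivative[symmetric]
          by (auto intro!: derivative_eq_intros)
        ultimately have "(f has_vector_derivative (\<beta> - p \<bullet> c)) (at t within {a..b})"
          unfolding f_def by (rule has_vector_derivative_diff[rotated])
        then obtain d where "0 < d" and d: "\<And>s. s \<in> {a..b} \<Longrightarrow> \<bar>s - t\<bar> < d \<Longrightarrow>
            \<bar>f s - f t - (s - t) * (\<beta> - p \<bullet> c)\<bar> \<le> e * \<bar>s - t\<bar>"
          using \<open>0 < e\<close> unfolding has_vector_derivative_def has_derivative_within_alt real_norm_def real_scaleR_def
          by blast
        have "f v - f u \<le> e * (v - u)" if uv: "a \<le> u" "u \<le> t" "t \<le> v" "v \<le> b" "v - u < d" for u v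
        proof -
          have "f v - f t \<le> (v - t) * (\<beta> - p \<bullet> c) + e * (v - t)" 
            using d[of v] uv by (auto simp: abs_le_iff)
          moreover have "f t - f u \<le> (t - u) * (\<beta> - p \<bullet> c) + e * (t - u)"
            using d[of u] uv by (auto simp: abs_le_iff algebra_simps)
          moreover have "(v - t) * (\<beta> - p \<bullet> c) \<le> 0" "(t - u) * (\<beta> - p \<bullet> c) \<le> 0"
            using D uv by (auto intro: mult_nonneg_nonpos)
          ultimately show ?thesis by (simp add: right_diff_distrib)
        qed
        then show "\<exists>d>0. \<forall>u v. a \<le> u \<and> u \<le> t \<and> t \<le> v \<and> v \<le> b \<and> v - u < d \<longrightarrow> f v - f u \<le> e * (v - u)"
          using \<open>0 < d\<close> by (intro exI[of _ d]) simp
      qed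
    qed
    then have "\<beta> * (b - a) \<le> p \<bullet> (x b - x a)" by (simp add: f_def algebra_simps inner_diff_right)
    also have "\<dots> = (b - a) * (p \<bullet> q)" using q by simp
    also have "\<dots> < (b - a) * \<beta>" using p(1) \<open>a < b\<close> by simp
    finally show False by (simp add: mult.commute)
  qed
  then show ?thesis using q by blast
qed

lemma abs_continuous_on_modulus:
  assumes "abs_continuous_on {a..b} f" "0 < e"
  obtains d where "0 < d" "\<And>u v. a \<le> u \<Longrightarrow> u \<le> v \<Longrightarrow> v \<le> b \<Longrightarrow> v - u < d \<Longrightarrow> norm (f v - f u) < e"
proof -
  have "\<exists>\<delta>>0. \<forall>D. D division_of \<Union>D \<and> \<Union>D \<subseteq> {a..b} \<and> (\<Sum>k\<in>D. Sup k - Inf k) < \<delta> \<longrightarrow>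
        (\<Sum>k\<in>D. norm (f (Sup k) - f (Inf k))) < e"
    using assms unfolding abs_continuous_on_def by simp
  then obtain \<delta> where "0 < \<delta>" and \<delta>:
    "\<And>D. D division_of \<Union>D \<Longrightarrow> \<Union>D \<subseteq> {a..b} \<Longrightarrow> (\<Sum>k\<in>D. Sup k - Inf k) < \<delta> \<Longrightarrow>
        (\<Sum>k\<in>D. norm (f (Sup k) - f (Inf k))) < e"
    by auto
  show thesis
  proof (rule that[OF \<open>0 < \<delta>\<close>])
    fix u v assume uv: "a \<le> u" "u \<le> v" "v \<le> b" "v - u < \<delta>"
    have "{{u..v}} division_of \<Union>{{u..v}}"
      using division_of_self[of u v] uv by simp
    then show "norm (f v - f u) < e" using \<delta>[of "{{u..v}}"] uv by simp
  qed
qed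

lemma nonincreasing_tendsto_at_top:
  fixes f :: "real \<Rightarrow> real"
  assumes mono: "\<And>s t. 0 \<le> s \<Longrightarrow> s \<le> t \<Longrightarrow> f t \<le> f s" and low: "\<And>t. 0 \<le> t \<Longrightarrow> b \<le> f t"
  obtains l where "(f \<longlongrightarrow> l) at_top" "\<And>t. 0 \<le> t \<Longrightarrow> l \<le> f t"
proof -
  define l where "l = Inf (f ` {0..})"
  have bdd: "bdd_below (f ` {0..})" using low by (auto intro!: bdd_belowI[of _ b])
  have l: "l \<le> f t" if "0 \<le> t" for t
    unfolding l_def using that by (intro cInf_lower bdd) auto
  have "(f \<longlongrightarrow> l) at_top"
  proof (rule tendstoI)
    fix e :: real assume "0 < e"
    then have "Inf (f ` {0..}) < l + e" by (simp add: l_def)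
    then obtain t where t: "0 \<le> t" "f t < l + e"
      using cInf_less_iff[OF _ bdd, of "l + e"] by auto
    have "dist (f s) l < e" if "t \<le> s" for s
      using l[of s] mono[of t s] t that by (simp add: dist_real_def)
    then show "\<forall>\<^sub>F s in at_top. dist (f s) l < e" unfolding eventually_at_top_linorder by blast
  qed
  then show thesis using l that by blast
qed

section \<open>Lipschitz functions at their zeros\<close>

text \<open>
  A quantitative trace of the Lebesgue density theorem. If \<open>h\<close> fails to be flat at a zero \<open>t\<close>, then at
  arbitrarily small scales \<open>\<rho>\<close> there is an interval of length proportional to \<open>\<rho>\<close>, within distance
  \<open>2 \<rho>\<close> of \<open>t\<close>, that is free of zeros. A Vitali covering of the bad points makes these intervals disjoint. They
  fill a fixed proportion of the covering but lie in an open neighbourhood of the zero set with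
  the zero set removed, which can be chosen of arbitrarily small measure.
\<close>

lemma lipschitz_zero_set_flat:
  fixes h :: "real \<Rightarrow> real"
  assumes lip: "L-lipschitz_on UNIV h"
  shows "AE t in lebesgue. h t = 0 \<longrightarrow> (\<forall>e>0. \<exists>d>0. \<forall>s. \<bar>s - t\<bar> < d \<longrightarrow> \<bar>h s\<bar> \<le> e * \<bar>s - t\<bar>)"
proof -
  define Z where "Z = {t. h t = 0}"
  define bad where "bad e = {t\<in>Z. \<forall>d>0. \<exists>s. \<bar>s - t\<bar> < d \<and> e * \<bar>s - t\<bar> < \<bar>h s\<bar>}" for e
  have hL: "\<bar>h u - h v\<bar> \<le> L * \<bar>u - v\<bar>" for u v
    using lipschitz_onD[OF lip, of u v] by (simp add: dist_real_def)
  have "continuous_on UNIV h" using lip lipschitz_on_continuous_on by blast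
  then have "closed Z" unfolding Z_def by (simp add: closed_Collect_eq)
  have neg: "negligible (bad e)" if "0 < e" for e
  proof (cases "e < L")
    case False
    have "bad e = {}"
    proof (rule ccontr)
      assume "bad e \<noteq> {}"
      then obtain t where t: "t \<in> bad e" by blast
      then have "h t = 0" by (simp add: bad_def Z_def)
      obtain s where "e * \<bar>s - t\<bar> < \<bar>h s\<bar>"
        using t zero_less_one unfolding bad_def by blast
      then have "e * \<bar>s - t\<bar> < L * \<bar>s - t\<bar>" using hL[of s t] \<open>h t = 0\<close> by simp
      then show False using False by (simp add: mult_less_cancel_right)
    qed
    then show ?thesis by simp
  next
    case True
    show ?thesis unfolding negligible_outer_le
    proof (intro allI impI)
      fix \<eta> :: real assume "0 < \<eta>"
      \<comment> \<open>The factor 10 comes from Vitali balls of radius 2\<rho> enlarged five times.\<close>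
      have "0 < e * \<eta> / (10 * L)" using \<open>0 < \<eta>\<close> \<open>0 < e\<close> True by simp
      moreover have "Z \<in> sets lebesgue" using \<open>closed Z\<close> by (metis borel_closed sets_completionI_sets sets_lborel)
      ultimately obtain T where T: "open T" "Z \<subseteq> T" "T - Z \<in> lmeasurable" 
        "emeasure lebesgue (T - Z) < ennreal (e * \<eta> / (10 * L))"
        using sets_lebesgue_outer_open by blast
      then have mT: "measure lebesgue (T - Z) < e * \<eta> / (10 * L)"
        using \<open>0 < e * \<eta> / (10 * L)\<close> by (simp add: emeasure_eq_measure2 ennreal_less_iff)
      have "\<exists>s. s \<noteq> t \<and> \<bar>s - t\<bar> \<le> 1 \<and> e * \<bar>s - t\<bar> < \<bar>h s\<bar> \<and> cball t (2 * \<bar>s - t\<bar>) \<subseteq> T" 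
        if "t \<in> bad e" for t
      proof -
        have "t \<in> T" using that T by (auto simp: bad_def)
        then obtain d where d: "0 < d" "cball t d \<subseteq> T" using \<open>open T\<close> open_contains_cball by blast
        then have "0 < min 1 (d/2)" by simp
        then obtain s where s: "\<bar>s - t\<bar> < min 1 (d/2)" "e * \<bar>s - t\<bar> < \<bar>h s\<bar>"
          using \<open>t \<in> bad e\<close> unfolding bad_def by blast
        have "h t = 0" using that by (auto simp: bad_def Z_def)
        then have "s \<noteq> t" using s by auto
        moreover have "cball t (2 * \<bar>s - t\<bar>) \<subseteq> T" using s d by (auto simp: subset_iff)
        ultimately show ?thesis using s by auto
      qed
      then obtain s where s: "\<And>t. t \<in> bad e \<Longrightarrow> s t \<noteq> t \<and> \<bar>s t - t\<bar> \<le> 1 \<and> e * \<bar>s t - t\<bar> < \<bar>h (s t)\<bar> \<and> cball t (2 * \<bar>s t - t\<bar>) \<subseteq> T"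
        by metis
      define \<rho> where "\<rho> t = \<bar>s t - t\<bar>" for t
      define J where "J t = ball (s t) (e * \<rho> t / L)" for t
      have \<rho>: "0 < \<rho> t" "\<rho> t \<le> 1" if "t \<in> bad e" for t using s[OF that] by (auto simp: \<rho>_def)
      have J1: "J t \<subseteq> cball t (2 * \<rho> t)" if "t \<in> bad e" for t
      proof -
        have "e * \<rho> t / L \<le> \<rho> t" using True \<rho>[OF that] \<open>0 < e\<close> by (simp add: field_simps)
        then have "dist (s t) u < \<rho> t" if "u \<in> J t" for u
          using that by (simp add: J_def)
        moreover have "dist t u \<le> dist (s t) u + \<rho> t" for u
          by (simp add: dist_real_def \<rho>_def)
        ultimately have "dist t u \<le> 2 * \<rho> t" if "u \<in> J t" for u
          using that by (smt (verit))
        then show ?thesis by auto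
      qed
      have J2: "J t \<subseteq> T - Z" if "t \<in> bad e" for t
      proof -
        have "u \<notin> Z" if "u \<in> J t" for u
        proof
          assume "u \<in> Z"
          then have "\<bar>h (s t)\<bar> \<le> L * \<bar>s t - u\<bar>" using hL[of "s t" u] by (simp add: Z_def)
          also have "\<dots> < L * (e * \<rho> t / L)" 
            using that True \<open>0 < e\<close> by (intro mult_strict_left_mono) (auto simp: J_def dist_real_def)
          also have "\<dots> = e * \<rho> t" using True \<open>0 < e\<close> by simp
          finally show False using s[OF \<open>t \<in> bad e\<close>] by (simp add: \<rho>_def)
        qed
        then show ?thesis using J1[OF that] s[OF that] by (auto simp: \<rho>_def)
      qed
      obtain C where C: "countable C" "C \<subseteq> bad e"
        "pairwise (\<lambda>i j. disjnt (cball i (2 * \<rho> i)) (cball j (2 * \<rho> j))) C"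
        "bad e \<subseteq> (\<Union>i\<in>C. cball i (5 * (2 * \<rho> i)))"
      proof (rule Vitali_covering_lemma_cballs[where S = "bad e" and K = "bad e" and a = "\<lambda>t. t" and r = "\<lambda>t. 2 * \<rho> t" and B = 2])
        show "bad e \<subseteq> (\<Union>i\<in>bad e. cball i (2 * \<rho> i))" using \<rho> by force
        show "\<And>i. i \<in> bad e \<Longrightarrow> 0 < 2 * \<rho> i \<and> 2 * \<rho> i \<le> 2" using \<rho> by auto
      qed blast
      have bnd: "measure lebesgue (\<Union>i\<in>I. cball i (5 * (2 * \<rho> i))) \<le> \<eta>" if I: "I \<subseteq> C" "finite I" for I
      proof -
        have Ib: "I \<subseteq> bad e" using I C by blast
        have "measure lebesgue (\<Union>i\<in>I. cball i (5 * (2 * \<rho> i))) \<le> (\<Sum>i\<in>I. measure lebesgue (cball i (5 * (2 * \<rho> i))))"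
          using I by (intro measure_UNION_le) auto
        also have "\<dots> = (\<Sum>i\<in>I. (10 * L / e) * measure lebesgue (J i))"
        proof (rule sum.cong[OF refl])
          fix i assume "i \<in> I"
          then have "0 < \<rho> i" using \<rho> Ib by auto
          then show "measure lebesgue (cball i (5 * (2 * \<rho> i))) = (10 * L / e) * measure lebesgue (J i)"
            using \<open>0 < e\<close> True by (simp add: J_def cball_eq_atLeastAtMost ball_eq_greaterThanLessThan)
        qed
        also have "\<dots> = (10 * L / e) * (\<Sum>i\<in>I. measure lebesgue (J i))" by (simp add: sum_distrib_left)
        also have "(\<Sum>i\<in>I. measure lebesgue (J i)) = measure lebesgue (\<Union>i\<in>I. J i)"
        proof (rule measure_UNION'[symmetric])
          show "finite I" by fact
          show "\<And>i. i \<in> I \<Longrightarrow> J i \<in> fmeasurable lebesgue" by (simp add: J_def)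
          show "pairwise (\<lambda>i j. disjnt (J i) (J j)) I"
            using C(3) I(1) Ib J1 unfolding pairwise_def by (meson disjnt_subset1 disjnt_subset2 subsetD)
        qed
        also have "(10 * L / e) * measure lebesgue (\<Union>i\<in>I. J i) \<le> (10 * L / e) * measure lebesgue (T - Z)"
          using \<open>0 < e\<close> True J2 Ib T(3) I by (intro mult_left_mono measure_mono_fmeasurable) (auto simp: J_def)
        also have "\<dots> \<le> (10 * L / e) * (e * \<eta> / (10 * L))"
          using \<open>0 < e\<close> True mT by (intro mult_left_mono) auto
        also have "\<dots> = \<eta>" using \<open>0 < e\<close> True by simp
        finally show ?thesis .
      qed
      show "\<exists>T. bad e \<subseteq> T \<and> T \<in> lmeasurable \<and> measure lebesgue T \<le> \<eta>"
      proof (intro exI conjI)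
        show "bad e \<subseteq> (\<Union>i\<in>C. cball i (5 * (2 * \<rho> i)))" by (rule C(4))
        show "(\<Union>i\<in>C. cball i (5 * (2 * \<rho> i))) \<in> lmeasurable"
          by (rule fmeasurable_UN_bound[OF C(1) _ bnd]) auto
        show "measure lebesgue (\<Union>i\<in>C. cball i (5 * (2 * \<rho> i))) \<le> \<eta>"
          by (rule measure_UN_bound[OF C(1) _ bnd]) auto
      qed
    qed
  qed
  have "negligible (\<Union>n. bad (1 / real (Suc n)))"
    by (intro negligible_countable_Union) (auto intro: neg)
  then have "AE t in lebesgue. t \<notin> (\<Union>n. bad (1 / real (Suc n)))"
    unfolding negligible_iff_null_sets by (rule AE_not_in)
  then show ?thesis
  proof (rule AE_mp, intro AE_I2 impI allI)
    fix t e :: real assume t: "t \<notin> (\<Union>n. bad (1 / real (Suc n)))" "h t = 0" "0 < e"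
    obtain n where n: "1 / real (Suc n) < e" using \<open>0 < e\<close> nat_approx_posE by blast
    have "t \<notin> bad (1 / real (Suc n))" using t by blast
    then have "\<exists>d>0. \<forall>s. \<bar>s - t\<bar> < d \<longrightarrow> \<not> 1 / real (Suc n) * \<bar>s - t\<bar> < \<bar>h s\<bar>"
      using t(2) unfolding bad_def Z_def by blast
    then obtain d where "0 < d" and d: "\<And>s. \<bar>s - t\<bar> < d \<Longrightarrow> \<bar>h s\<bar> \<le> 1 / real (Suc n) * \<bar>s - t\<bar>"
      unfolding not_less by blast
    have "\<bar>h s\<bar> \<le> e * \<bar>s - t\<bar>" if "\<bar>s - t\<bar> < d" for s
      using d[OF that] mult_right_mono[of "1 / real (Suc n)" e "\<bar>s - t\<bar>"] n by linarith
    then show "\<exists>d>0. \<forall>s. \<bar>s - t\<bar> < d \<longrightarrow> \<bar>h s\<bar> \<le> e * \<bar>s - t\<bar>" using \<open>0 < d\<close> by blast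
  qed
qed

lemma lipschitz_zero_set_flat_interval:
  fixes h :: "real \<Rightarrow> real"
  assumes lip: "L-lipschitz_on {0..T} h" and "0 \<le> T"
  shows "AE t in lebesgue. t \<in> {0..T} \<longrightarrow> h t = 0 \<longrightarrow>
    (\<forall>e>0. \<exists>d>0. \<forall>s\<in>{0..T}. \<bar>s - t\<bar> < d \<longrightarrow> \<bar>h s\<bar> \<le> e * \<bar>s - t\<bar>)"
proof -
  \<comment> \<open>Clamping the argument extends \<open>h\<close> to the whole line without increasing the Lipschitz constant.\<close>
  define g where "g s = h (max 0 (min T s))" for s
  have gh: "g s = h s" if "s \<in> {0..T}" for s using that by (simp add: g_def)
  have "L-lipschitz_on UNIV g"
  proof (rule lipschitz_onI)
    fix u v :: real
    have "dist (g u) (g v) \<le> L * dist (max 0 (min T u)) (max 0 (min T v))"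
      unfolding g_def using \<open>0 \<le> T\<close> by (intro lipschitz_onD[OF lip]) auto
    also have "\<dots> \<le> L * dist u v"
      using lipschitz_on_nonneg[OF lip] by (intro mult_left_mono) (auto simp: dist_real_def)
    finally show "dist (g u) (g v) \<le> L * dist u v" .
  qed (rule lipschitz_on_nonneg[OF lip])
  from lipschitz_zero_set_flat[OF this] show ?thesis
  proof (rule AE_mp, intro AE_I2 impI allI)
    fix t e :: real
    assume t: "g t = 0 \<longrightarrow> (\<forall>e>0. \<exists>d>0. \<forall>s. \<bar>s - t\<bar> < d \<longrightarrow> \<bar>g s\<bar> \<le> e * \<bar>s - t\<bar>)"
      and "t \<in> {0..T}" "h t = 0" "0 < e"
    then have "g t = 0" using gh by simp
    then obtain d where "0 < d" "\<And>s. \<bar>s - t\<bar> < d \<Longrightarrow> \<bar>g s\<bar> \<le> e * \<bar>s - t\<bar>"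
      using t \<open>0 < e\<close> by blast
    then show "\<exists>d>0. \<forall>s\<in>{0..T}. \<bar>s - t\<bar> < d \<longrightarrow> \<bar>h s\<bar> \<le> e * \<bar>s - t\<bar>"
      using gh by (metis)
  qed
qed

section \<open>The root of a spanning tree\<close>

text \<open>
  The spanning tree enters the proof only through this property of its root: from a node of \<open>Z\<close>, following
  the tree backwards along in-neighbours leads to \<open>r\<close>. That \<open>r\<close> reaches every node along tree arcs is shown by
  walking through the underlying undirected tree: an arc traversed against its direction
  is the only arc into its head, hence the last arc of the directed path already found.
\<close>

lemma spanning_tree_root:
  fixes A :: "real^'n::finite^'n"
  assumes W: "weighted_digraph E A" and T: "directed_spanning_tree T (digraph_of E)"
  obtains r where "\<And>Z. Z \<noteq> {} \<Longrightarrow> (\<And>k j. k \<in> Z \<Longrightarrow> 0 < A $ k $ j \<Longrightarrow> j \<in> Z) \<Longrightarrow> r \<in> Z"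
proof -
  have sp: "spanning T (digraph_of E)" and con: "Digraph_Component.connected T"
    using T by (auto simp: directed_spanning_tree_def)
  have V: "verts T = UNIV" and arcs: "arcs T \<subseteq> E" and tl: "tail T = fst" and hd: "head T = snd"
    using sp by (auto simp: spanning_def subgraph_def compatible_def digraph_of_def)
  obtain r where r: "in_degree T r = 0" "\<And>v. v \<noteq> r \<Longrightarrow> in_degree T v = 1"
    using T by (auto simp: directed_spanning_tree_def digraph_of_def)
  have fin: "finite (in_arcs T v)" for v
    by (rule finite_subset[of _ UNIV]) auto
  have no_in: "snd e \<noteq> r" if "e \<in> arcs T" for e
  proof
    assume "snd e = r"
    then have "e \<in> in_arcs T r" using that by (simp add: hd)
    then show False using r(1) fin[of r] by (auto simp: in_degree_def)
  qed
  have uniq: "e = e'" if "e \<in> arcs T" "e' \<in> arcs T" "snd e = snd e'" for e e'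
  proof -
    have "card (in_arcs T (snd e)) = 1" using r(2)[of "snd e"] no_in that by (simp add: in_degree_def)
    then obtain a where "in_arcs T (snd e) = {a}" using card_1_singletonE by blast
    moreover have "e \<in> in_arcs T (snd e)" "e' \<in> in_arcs T (snd e)" using that by (auto simp: hd)
    ultimately show ?thesis by (metis singletonD)
  qed
  have reach: "(r, v) \<in> (arcs T)\<^sup>*" for v
  proof -
    have "r \<rightarrow>\<^sup>*\<^bsub>with_proj (mk_symmetric T)\<^esub> v"
      using con V by (simp add: Digraph_Component.connected_def strongly_connected_def)
    then have "(r, v) \<in> (arcs_ends (with_proj (mk_symmetric T)))\<^sup>*" by (rule reachable_rtranclI)
    then show ?thesis
    proof (induction rule: rtrancl_induct)
      case base
      show ?case by simp
    next
      case (step y z)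
      then have "(y, z) \<in> parcs (mk_symmetric T)" by simp
      then have "(y, z) \<in> arcs T \<or> (z, y) \<in> arcs T"
        by (auto simp: parcs_mk_symmetric tl hd)
      then show ?case
      proof
        assume "(y, z) \<in> arcs T"
        then show ?thesis using step.IH by (rule rtrancl_into_rtrancl[rotated])
      next
        assume zy: "(z, y) \<in> arcs T"
        then have "y \<noteq> r" using no_in by fastforce
        with step.IH obtain w where w: "(r, w) \<in> (arcs T)\<^sup>*" "(w, y) \<in> arcs T"
          by (metis rtranclE)
        have "w = z" using uniq[OF zy w(2)] by simp
        then show ?thesis using w by simp
      qed
    qed
  qed
  show thesis
  proof (rule that)
    fix Z :: "'n set" assume "Z \<noteq> {}" and Z: "\<And>k j. k \<in> Z \<Longrightarrow> 0 < A $ k $ j \<Longrightarrow> j \<in> Z"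
    then obtain z where "z \<in> Z" by blast
    show "r \<in> Z" using reach[of z]
    proof (induction rule: converse_rtrancl_induct)
      case base
      show ?case by fact
    next
      case (step y w)
      then have "0 < A $ w $ y" using W arcs by (auto simp: weighted_digraph_def)
      then show ?case using Z step.IH by blast
    qed
  qed
qed

section \<open>The set-valued quantizer\<close>

text \<open>
  The closed interval between the left and the right limit of the quantizer at \<open>z\<close>. In terms of
  the thresholds between consecutive levels, its monotonicity and symmetry are immediate.
\<close>

definition quantizer_values :: "real \<Rightarrow> real \<Rightarrow> real set" where
  "quantizer_values \<Delta> z = {w. (\<forall>k::int. (of_int k - 1 / 2) * \<Delta> < z \<longrightarrow> of_int k * \<Delta> \<le> w) \<and>
                              (\<forall>k::int. z < (of_int k + 1 / 2) * \<Delta> \<longrightarrow> w \<le> of_int k * \<Delta>)}"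

lemma quantizer_values_lower: "w \<in> quantizer_values \<Delta> z \<Longrightarrow> (of_int k - 1 / 2) * \<Delta> < z \<Longrightarrow> of_int k * \<Delta> \<le> w"
  and quantizer_values_upper: "w \<in> quantizer_values \<Delta> z \<Longrightarrow> z < (of_int k + 1 / 2) * \<Delta> \<Longrightarrow> w \<le> of_int k * \<Delta>"
  by (auto simp: quantizer_values_def)

lemma quantizer_values_eq_interval:
  assumes "0 < \<Delta>"
  shows "quantizer_values \<Delta> z = {of_int (\<lceil>z / \<Delta> + 1 / 2\<rceil> - 1) * \<Delta> .. of_int \<lfloor>z / \<Delta> + 1 / 2\<rfloor> * \<Delta>}"
proof -
  have lo: "(of_int k - 1 / 2) * \<Delta> < z \<longleftrightarrow> k \<le> \<lceil>z / \<Delta> + 1 / 2\<rceil> - 1" for k :: int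
  proof -
    have "(of_int k - 1 / 2) * \<Delta> < z \<longleftrightarrow> of_int k < z / \<Delta> + 1 / 2"
      using assms by (simp add: pos_less_divide_eq[symmetric] diff_less_eq)
    also have "\<dots> \<longleftrightarrow> k < \<lceil>z / \<Delta> + 1 / 2\<rceil>" by (simp add: less_ceiling_iff)
    finally show ?thesis by linarith
  qed
  have hi: "z < (of_int k + 1 / 2) * \<Delta> \<longleftrightarrow> \<lfloor>z / \<Delta> + 1 / 2\<rfloor> \<le> k" for k :: int
  proof -
    have "z < (of_int k + 1 / 2) * \<Delta> \<longleftrightarrow> z / \<Delta> < of_int k + 1 / 2"
      using assms by (simp add: pos_divide_less_eq)
    also have "\<dots> \<longleftrightarrow> z / \<Delta> + 1 / 2 < of_int (k + 1)" by auto
    also have "\<dots> \<longleftrightarrow> \<lfloor>z / \<Delta> + 1 / 2\<rfloor> < k + 1" by (simp only: floor_less_iff)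
    finally show ?thesis by linarith
  qed
  show ?thesis
  proof (intro set_eqI iffI)
    fix w assume w: "w \<in> quantizer_values \<Delta> z"
    show "w \<in> {of_int (\<lceil>z / \<Delta> + 1 / 2\<rceil> - 1) * \<Delta> .. of_int \<lfloor>z / \<Delta> + 1 / 2\<rfloor> * \<Delta>}"
      unfolding atLeastAtMost_iff
      by (intro conjI quantizer_values_lower[OF w] quantizer_values_upper[OF w] lo[THEN iffD2] hi[THEN iffD2] order_refl)
  next
    fix w assume w: "w \<in> {of_int (\<lceil>z / \<Delta> + 1 / 2\<rceil> - 1) * \<Delta> .. of_int \<lfloor>z / \<Delta> + 1 / 2\<rfloor> * \<Delta>}"
    have "of_int k * \<Delta> \<le> w" if "k \<le> \<lceil>z / \<Delta> + 1 / 2\<rceil> - 1" for k :: int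
    proof -
      have "of_int k * \<Delta> \<le> of_int (\<lceil>z / \<Delta> + 1 / 2\<rceil> - 1) * \<Delta>"
        by (intro mult_right_mono of_int_le_iff[THEN iffD2] that less_imp_le[OF assms])
      also have "\<dots> \<le> w" using w by simp
      finally show ?thesis .
    qed
    moreover have "w \<le> of_int k * \<Delta>" if "\<lfloor>z / \<Delta> + 1 / 2\<rfloor> \<le> k" for k :: int
    proof -
      have "w \<le> of_int \<lfloor>z / \<Delta> + 1 / 2\<rfloor> * \<Delta>" using w by simp
      also have "\<dots> \<le> of_int k * \<Delta>"
        by (intro mult_right_mono of_int_le_iff[THEN iffD2] that less_imp_le[OF assms])
      finally show ?thesis .
    qed
    ultimately show "w \<in> quantizer_values \<Delta> z"
      unfolding quantizer_values_def mem_Collect_eq lo hi by (intro conjI allI impI)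
  qed
qed

lemma sym_quantizer_in_values:
  assumes "0 < \<Delta>"
  shows "sym_quantizer \<Delta> z \<in> quantizer_values \<Delta> z"
proof -
  have "\<lceil>z / \<Delta> + 1 / 2\<rceil> - 1 \<le> \<lfloor>z / \<Delta> + 1 / 2\<rfloor>" by linarith
  then show ?thesis using assms
    by (simp only: quantizer_values_eq_interval[OF assms] sym_quantizer_def) (simp del: of_int_diff)
qed

lemma quantizer_values_mono:
  assumes "0 < \<Delta>" "z < z'" "w \<in> quantizer_values \<Delta> z" "w' \<in> quantizer_values \<Delta> z'"
  shows "w \<le> w'"
proof -
  define k where "k = \<lfloor>z / \<Delta> + 1 / 2\<rfloor>"
  have k: "of_int k \<le> z / \<Delta> + 1 / 2" "z / \<Delta> + 1 / 2 < of_int k + 1" 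
    using floor_correct[of "z / \<Delta> + 1 / 2"] unfolding k_def by simp_all
  have "z / \<Delta> * \<Delta> = z" using assms(1) by simp
  have "z / \<Delta> * \<Delta> < (of_int k + 1 / 2) * \<Delta>"
    using k assms(1) by (intro mult_strict_right_mono) auto
  then have "w \<le> of_int k * \<Delta>" using quantizer_values_upper[OF assms(3)] \<open>z / \<Delta> * \<Delta> = z\<close> by simp
  moreover have "(of_int k - 1 / 2) * \<Delta> \<le> z / \<Delta> * \<Delta>"
    using k assms(1) by (intro mult_right_mono) auto
  then have "of_int k * \<Delta> \<le> w'" using quantizer_values_lower[OF assms(4)] \<open>z / \<Delta> * \<Delta> = z\<close> assms(2) by simp
  ultimately show ?thesis by simp
qed

lemma quantizer_values_bound:
  assumes "0 < \<Delta>" "w \<in> quantizer_values \<Delta> z"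
  shows "\<bar>w\<bar> \<le> \<bar>z\<bar> + \<Delta>"
proof -
  have w: "of_int (\<lceil>z / \<Delta> + 1 / 2\<rceil> - 1) * \<Delta> \<le> w" "w \<le> of_int \<lfloor>z / \<Delta> + 1 / 2\<rfloor> * \<Delta>"
    using assms(2) unfolding quantizer_values_eq_interval[OF assms(1)] by auto
  have "real_of_int \<lfloor>z / \<Delta> + 1 / 2\<rfloor> \<le> z / \<Delta> + 1" "z / \<Delta> - 1 \<le> real_of_int (\<lceil>z / \<Delta> + 1 / 2\<rceil> - 1)"
    by linarith+
  then have "real_of_int \<lfloor>z / \<Delta> + 1 / 2\<rfloor> * \<Delta> \<le> (z / \<Delta> + 1) * \<Delta>"
    "(z / \<Delta> - 1) * \<Delta> \<le> real_of_int (\<lceil>z / \<Delta> + 1 / 2\<rceil> - 1) * \<Delta>"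
    using assms(1) by (auto intro!: mult_right_mono simp del: of_int_diff)
  then have "w \<le> (z / \<Delta> + 1) * \<Delta>" "(z / \<Delta> - 1) * \<Delta> \<le> w"
    using w by (auto intro: order_trans)
  then have "w \<le> z + \<Delta>" "z - \<Delta> \<le> w"
    using assms(1) by (simp_all add: distrib_right left_diff_distrib)
  then show ?thesis by linarith
qed

lemma quantizer_values_uminus:
  assumes "w \<in> quantizer_values \<Delta> z"
  shows "- w \<in> quantizer_values \<Delta> (- z)"
proof -
  have "of_int k * \<Delta> \<le> - w" if "(of_int k - 1 / 2) * \<Delta> < - z" for k :: int
    using quantizer_values_upper[OF assms, of "- k"] that by (simp add: algebra_simps)
  moreover have "- w \<le> of_int k * \<Delta>" if "- z < (of_int k + 1 / 2) * \<Delta>" for k :: int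
    using quantizer_values_lower[OF assms, of "- k"] that by (simp add: algebra_simps)
  ultimately show ?thesis by (simp add: quantizer_values_def)
qed

text \<open>
  Upper semicontinuity holds in this exact form, without enlarging the right-hand side, because the
  thresholds are isolated: a small perturbation of \<open>z\<close> crosses no threshold, at most it leaves one at \<open>z\<close>.
\<close>

lemma quantizer_values_usc:
  assumes "0 < \<Delta>"
  obtains \<epsilon> where "0 < \<epsilon>" "\<And>z'. \<bar>z' - z\<bar> < \<epsilon> \<Longrightarrow> quantizer_values \<Delta> z' \<subseteq> quantizer_values \<Delta> z"
proof -
  define lo hi where "lo = \<lceil>z / \<Delta> + 1 / 2\<rceil> - 1" and "hi = \<lfloor>z / \<Delta> + 1 / 2\<rfloor>"
  have Q: "quantizer_values \<Delta> z = {of_int lo * \<Delta> .. of_int hi * \<Delta>}"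
    using quantizer_values_eq_interval[OF assms] by (simp add: lo_def hi_def)
  have "real_of_int lo - 1 / 2 < z / \<Delta>" "z / \<Delta> < of_int hi + 1 / 2"
    unfolding lo_def hi_def by linarith+
  then have *: "(of_int lo - 1 / 2) * \<Delta> < z" "z < (of_int hi + 1 / 2) * \<Delta>"
    using assms by (simp_all add: pos_less_divide_eq pos_divide_less_eq)
  define \<epsilon> where "\<epsilon> = min (z - (of_int lo - 1 / 2) * \<Delta>) ((of_int hi + 1 / 2) * \<Delta> - z)"
  show thesis
  proof (rule that)
    show "0 < \<epsilon>" using * by (simp add: \<epsilon>_def)
    fix z' assume "\<bar>z' - z\<bar> < \<epsilon>"
    then have "(of_int lo - 1 / 2) * \<Delta> < z'" "z' < (of_int hi + 1 / 2) * \<Delta>"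
      unfolding \<epsilon>_def by linarith+
    then show "quantizer_values \<Delta> z' \<subseteq> quantizer_values \<Delta> z"
      unfolding Q using quantizer_values_lower quantizer_values_upper by fastforce
  qed
qed

section \<open>Trajectories of the differential inclusion\<close>

text \<open>
  The node \<open>r\<close> stands for the root of the spanning tree. A set \<open>Z\<close> as in the last assumption is one that
  no edge enters from outside.
\<close>

locale quantized_consensus =
  fixes A :: "real^'n::finite^'n" and \<Delta> :: real and r :: 'n
  assumes nonneg: "\<And>i j. 0 \<le> A $ i $ j"
    and \<Delta>_pos: "0 < \<Delta>"
    and root: "\<And>Z. Z \<noteq> {} \<Longrightarrow> (\<And>k j. k \<in> Z \<Longrightarrow> 0 < A $ k $ j \<Longrightarrow> j \<in> Z) \<Longrightarrow> r \<in> Z"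
begin

definition qvals :: "real^'n \<Rightarrow> (real^'n) set" where
  "qvals y = {w. \<forall>i. w $ i \<in> quantizer_values \<Delta> (y $ i)}"

definition velocity :: "real^'n \<Rightarrow> real^'n" where
  "velocity w = - (laplacian A *v w)"

text \<open>
  The differential inclusion in terms of difference quotients: all mean velocities over short intervals around
  \<open>t\<close> are admissible velocities at \<open>t\<close>. Unlike a condition on derivatives, this passes to pointwise limits.
\<close>

definition trajectory :: "(real \<Rightarrow> real^'n) \<Rightarrow> bool" where
  "trajectory y \<longleftrightarrow> (\<forall>t\<ge>0. \<exists>h>0. \<forall>u v. 0 \<le> u \<and> u \<le> t \<and> t \<le> v \<and> v - u < h \<longrightarrow>
      (\<exists>w\<in>qvals (y t). y v - y u = (v - u) *\<^sub>R velocity w))"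

lemma velocity_nth: "velocity w $ i = (\<Sum>j\<in>UNIV. A $ i $ j * (w $ j - w $ i))"
proof -
  have "(laplacian A *v w) $ i = (\<Sum>j\<in>UNIV. (if i = j then (\<Sum>k\<in>UNIV. A $ i $ k) * w $ j else 0) - A $ i $ j * w $ j)"
    by (auto simp: laplacian_def matrix_vector_mult_def algebra_simps intro!: sum.cong)
  also have "\<dots> = (\<Sum>k\<in>UNIV. A $ i $ k) * w $ i - (\<Sum>j\<in>UNIV. A $ i $ j * w $ j)"
    by (simp add: sum_subtractf)
  finally show ?thesis
    by (simp add: velocity_def sum_subtractf right_diff_distrib sum_distrib_right)
qed

lemma linear_velocity: "linear velocity"
  unfolding velocity_def by (intro linear_compose_neg matrix_vector_mul_linear)

lemma velocity_uminus: "velocity (- w) = - velocity w"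
  using linear_neg[OF linear_velocity] .

lemma qvals_eq_cbox:
  "qvals y = cbox (\<chi> i. of_int (\<lceil>y $ i / \<Delta> + 1 / 2\<rceil> - 1) * \<Delta>) (\<chi> i. of_int \<lfloor>y $ i / \<Delta> + 1 / 2\<rfloor> * \<Delta>)"
  unfolding qvals_def quantizer_values_eq_interval[OF \<Delta>_pos] by (auto simp: mem_box_cart)

lemma compact_qvals: "compact (qvals y)"
  unfolding qvals_eq_cbox by (rule compact_cbox)

lemma convex_qvals: "convex (qvals y)"
  unfolding qvals_eq_cbox by (rule convex_box)

lemma sym_quantizer_vec_in_qvals: "sym_quantizer_vec \<Delta> y \<in> qvals y"
  by (simp add: qvals_def sym_quantizer_vec_def sym_quantizer_in_values \<Delta>_pos)

lemma compact_velocity_qvals: "compact (velocity ` qvals y)"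
  by (intro compact_continuous_image compact_qvals linear_continuous_on)
     (simp add: linear_velocity linear_conv_bounded_linear[symmetric])

lemma convex_velocity_qvals: "convex (velocity ` qvals y)"
  by (rule convex_linear_image[OF linear_velocity convex_qvals])

lemma velocity_qvals_nonempty: "velocity ` qvals y \<noteq> {}"
  using sym_quantizer_vec_in_qvals by blast

lemma qvals_uminus: "w \<in> qvals y \<Longrightarrow> - w \<in> qvals (- y)"
  by (simp add: qvals_def quantizer_values_uminus)

lemma qvals_usc:
  obtains \<epsilon> where "0 < \<epsilon>" "\<And>y'. norm (y' - y) < \<epsilon> \<Longrightarrow> qvals y' \<subseteq> qvals y"
proof -
  have "\<exists>\<epsilon>>0. \<forall>z'. \<bar>z' - y $ i\<bar> < \<epsilon> \<longrightarrow> quantizer_values \<Delta> z' \<subseteq> quantizer_values \<Delta> (y $ i)" for i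
    using quantizer_values_usc[OF \<Delta>_pos, of "y $ i"] by metis
  then obtain \<epsilon> where \<epsilon>: "\<And>i. 0 < \<epsilon> i"
    "\<And>i z'. \<bar>z' - y $ i\<bar> < \<epsilon> i \<Longrightarrow> quantizer_values \<Delta> z' \<subseteq> quantizer_values \<Delta> (y $ i)"
    by metis
  show thesis
  proof (rule that)
    show "0 < Min (range \<epsilon>)" using \<epsilon>(1) by simp
    fix y' assume y': "norm (y' - y) < Min (range \<epsilon>)"
    have "quantizer_values \<Delta> (y' $ i) \<subseteq> quantizer_values \<Delta> (y $ i)" for i
    proof (rule \<epsilon>(2))
      have "\<bar>y' $ i - y $ i\<bar> \<le> norm (y' - y)" using component_le_norm_cart[of "y' - y" i] by simp
      also have "\<dots> < \<epsilon> i" using y' by simp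
      finally show "\<bar>y' $ i - y $ i\<bar> < \<epsilon> i" .
    qed
    then show "qvals y' \<subseteq> qvals y" by (auto simp: qvals_def)
  qed
qed

lemma qvals_bound:
  assumes "norm y \<le> R" "w \<in> qvals y"
  shows "norm w \<le> real CARD('n) * (R + \<Delta>)"
proof -
  have "norm w \<le> (\<Sum>i\<in>UNIV. \<bar>w $ i\<bar>)" by (rule norm_le_l1_cart)
  also have "\<dots> \<le> (\<Sum>i\<in>(UNIV::'n set). R + \<Delta>)"
  proof (rule sum_mono)
    fix i
    have "\<bar>w $ i\<bar> \<le> \<bar>y $ i\<bar> + \<Delta>"
      using assms(2) by (intro quantizer_values_bound[OF \<Delta>_pos]) (simp add: qvals_def)
    also have "\<bar>y $ i\<bar> \<le> norm y" by (rule component_le_norm_cart)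
    finally show "\<bar>w $ i\<bar> \<le> R + \<Delta>" using assms(1) by simp
  qed
  finally show ?thesis by simp
qed

text \<open>
  On a small ball around \<open>y\<close> the right-hand side already takes its values in the compact convex set
  \<open>velocity ` qvals y\<close>, so the closed convex hull adds nothing.
\<close>

lemma filippov_subset: "filippov (\<lambda>y. - (laplacian A *v sym_quantizer_vec \<Delta> y)) y \<subseteq> velocity ` qvals y"
proof -
  obtain \<epsilon> where \<epsilon>: "0 < \<epsilon>" "\<And>y'. norm (y' - y) < \<epsilon> \<Longrightarrow> qvals y' \<subseteq> qvals y" using qvals_usc by blast
  let ?X = "\<lambda>y. - (laplacian A *v sym_quantizer_vec \<Delta> y)"
  have "?X ` (ball y \<epsilon> - {}) \<subseteq> velocity ` qvals y"
  proof clarify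
    fix y' assume "y' \<in> ball y \<epsilon>"
    then have "qvals y' \<subseteq> qvals y" by (intro \<epsilon>) (simp add: dist_norm norm_minus_commute)
    then have "sym_quantizer_vec \<Delta> y' \<in> qvals y" using sym_quantizer_vec_in_qvals by blast
    then show "?X y' \<in> velocity ` qvals y" by (auto simp: velocity_def)
  qed
  then have "closure (convex hull (?X ` (ball y \<epsilon> - {}))) \<subseteq> velocity ` qvals y"
    by (intro closure_minimal hull_minimal convex_velocity_qvals compact_imp_closed compact_velocity_qvals)
  moreover have "filippov ?X y \<subseteq> closure (convex hull (?X ` (ball y \<epsilon> - {})))"
    unfolding filippov_def using \<epsilon>(1) by (intro INF_lower2[of \<epsilon>] INF_lower2[of "{}"]) auto
  ultimately show ?thesis by blast
qed

lemma filippov_solution_imp_trajectory: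
  assumes x: "complete_filippov_solution (\<lambda>y. - (laplacian A *v sym_quantizer_vec \<Delta> y)) x"
  shows "trajectory x"
  unfolding trajectory_def
proof (intro allI impI)
  fix t :: real assume "0 \<le> t"
  have ac: "abs_continuous_on {a..b} x" if "0 \<le> a" for a b
    using x that unfolding filippov_solution_on_def locally_abs_continuous_on_def by auto
  obtain \<epsilon> where \<epsilon>: "0 < \<epsilon>" "\<And>y'. norm (y' - x t) < \<epsilon> \<Longrightarrow> qvals y' \<subseteq> qvals (x t)" using qvals_usc by blast
  obtain d where d: "0 < d" "\<And>u v. 0 \<le> u \<Longrightarrow> u \<le> v \<Longrightarrow> v \<le> t + 1 \<Longrightarrow> v - u < d \<Longrightarrow> norm (x v - x u) < \<epsilon>"
    using abs_continuous_on_modulus[OF ac[of 0 "t + 1"] \<epsilon>(1)] by auto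
  have "\<exists>w\<in>qvals (x t). x v - x u = (v - u) *\<^sub>R velocity w"
    if uv: "0 \<le> u" "u \<le> t" "t \<le> v" "v - u < min d 1" for u v
  proof -
    have near: "qvals (x s) \<subseteq> qvals (x t)" if "s \<in> {u..v}" for s
    proof (rule \<epsilon>(2))
      show "norm (x s - x t) < \<epsilon>"
      proof (cases "s \<le> t")
        case True
        then show ?thesis using d(2)[of s t] uv that by (simp add: norm_minus_commute)
      next
        case False
        then show ?thesis using d(2)[of t s] uv that \<open>0 \<le> t\<close> by simp
      qed
    qed
    have "\<exists>c\<in>velocity ` qvals (x t). x v - x u = (v - u) *\<^sub>R c"
    proof (rule abs_continuous_increment_in_convex)
      show "abs_continuous_on {u..v} x" using ac uv by simp
      show "u \<le> v" using uv by simp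
      have "AE t in lebesgue. t \<in> {0..} \<longrightarrow>
        (\<exists>v\<in>filippov (\<lambda>y. - (laplacian A *v sym_quantizer_vec \<Delta> y)) (x t). (x has_vector_derivative v) (at t within {0..}))"
        using x unfolding filippov_solution_on_def by blast
      then show "AE s in lebesgue. s \<in> {u..v} \<longrightarrow>
        (\<exists>c\<in>velocity ` qvals (x t). (x has_vector_derivative c) (at s within {u..v}))"
      proof (rule AE_mp, intro AE_I2 impI)
        fix s assume s: "s \<in> {u..v}" and "s \<in> {0..} \<longrightarrow>
          (\<exists>c\<in>filippov (\<lambda>y. - (laplacian A *v sym_quantizer_vec \<Delta> y)) (x s). (x has_vector_derivative c) (at s within {0..}))"
        then obtain c where c: "c \<in> velocity ` qvals (x s)" "(x has_vector_derivative c) (at s within {0..})"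
          using uv filippov_subset by fastforce
        have "(x has_vector_derivative c) (at s within {u..v})"
          using c(2) by (rule has_vector_derivative_within_subset) (use uv in auto)
        then show "\<exists>c\<in>velocity ` qvals (x t). (x has_vector_derivative c) (at s within {u..v})"
          using c(1) near[OF s] by blast
      qed
    qed (use convex_velocity_qvals compact_velocity_qvals velocity_qvals_nonempty compact_imp_closed in auto)
    then show ?thesis by blast
  qed
  then show "\<exists>h>0. \<forall>u v. 0 \<le> u \<and> u \<le> t \<and> t \<le> v \<and> v - u < h \<longrightarrow> (\<exists>w\<in>qvals (x t). x v - x u = (v - u) *\<^sub>R velocity w)"
    using d(1) by (intro exI[of _ "min d 1"]) simp
qed

lemma trajectory_local:
  assumes "trajectory y" "0 \<le> t"
  obtains h where "0 < h" "\<And>u v. 0 \<le> u \<Longrightarrow> u \<le> t \<Longrightarrow> t \<le> v \<Longrightarrow> v - u < h \<Longrightarrow>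
      \<exists>w\<in>qvals (y t). y v - y u = (v - u) *\<^sub>R velocity w"
  using assms unfolding trajectory_def by metis

lemma trajectory_uminus:
  assumes "trajectory y"
  shows "trajectory (\<lambda>t. - y t)"
  unfolding trajectory_def
proof (intro allI impI)
  fix t :: real assume "0 \<le> t"
  from trajectory_local[OF assms this] obtain h where "0 < h"
    and h: "\<And>u v. 0 \<le> u \<Longrightarrow> u \<le> t \<Longrightarrow> t \<le> v \<Longrightarrow> v - u < h \<Longrightarrow>
      \<exists>w\<in>qvals (y t). y v - y u = (v - u) *\<^sub>R velocity w" by blast
  have "\<exists>w\<in>qvals (- y t). - y v - - y u = (v - u) *\<^sub>R velocity w"
    if uv: "0 \<le> u" "u \<le> t" "t \<le> v" "v - u < h" for u v
  proof -
    obtain w where w: "w \<in> qvals (y t)" "y v - y u = (v - u) *\<^sub>R velocity w" using h[OF uv] by blast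
    have "- y v - - y u = - (y v - y u)" by simp
    also have "\<dots> = (v - u) *\<^sub>R velocity (- w)" by (simp only: w(2) velocity_uminus scaleR_minus_right)
    finally show ?thesis using qvals_uminus[OF w(1)] by blast
  qed
  then show "\<exists>h>0. \<forall>u v. 0 \<le> u \<and> u \<le> t \<and> t \<le> v \<and> v - u < h \<longrightarrow>
      (\<exists>w\<in>qvals (- y t). - y v - - y u = (v - u) *\<^sub>R velocity w)"
    using \<open>0 < h\<close> by blast
qed

text \<open>
  By convexity, mean velocities in \<open>C\<close> over adjacent intervals combine to a mean velocity in \<open>C\<close>, so
  the local condition spreads over \<open>{a..b}\<close> by bisection.
\<close>

lemma trajectory_increment_in_convex:
  assumes y: "trajectory y" and ab: "0 \<le> a" "a \<le> b" and "convex C"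
    and C: "\<And>s. s \<in> {a..b} \<Longrightarrow> velocity ` qvals (y s) \<subseteq> C"
  shows "\<exists>c\<in>C. y b - y a = (b - a) *\<^sub>R c"
proof -
  define P where "P u v \<longleftrightarrow> (a \<le> u \<and> u \<le> v \<and> v \<le> b \<longrightarrow> (\<exists>c\<in>C. y v - y u = (v - u) *\<^sub>R c))" for u v
  have "P a b" using ab(2)
  proof (induction rule: Bolzano)
    case (trans u s v)
    show ?case unfolding P_def
    proof
      assume uv: "a \<le> u \<and> u \<le> v \<and> v \<le> b"
      then obtain c1 c2 where c: "c1 \<in> C" "y s - y u = (s - u) *\<^sub>R c1" "c2 \<in> C" "y v - y s = (v - s) *\<^sub>R c2"
        using trans unfolding P_def by auto
      show "\<exists>c\<in>C. y v - y u = (v - u) *\<^sub>R c"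
      proof (cases "u = v")
        case True
        then show ?thesis using c(1) by auto
      next
        case False
        then have "u < v" using uv by simp
        define \<theta> where "\<theta> = (v - s) / (v - u)"
        have \<theta>: "0 \<le> \<theta>" "\<theta> \<le> 1" "(v - u) * \<theta> = v - s" "(v - u) * (1 - \<theta>) = s - u"
          using \<open>u < v\<close> trans by (auto simp: \<theta>_def field_simps)
        have "(1 - \<theta>) *\<^sub>R c1 + \<theta> *\<^sub>R c2 \<in> C" using \<theta> c \<open>convex C\<close> by (simp add: convexD_alt)
        moreover have "y v - y u = (v - u) *\<^sub>R ((1 - \<theta>) *\<^sub>R c1 + \<theta> *\<^sub>R c2)"
        proof -
          have "y v - y u = (y s - y u) + (y v - y s)" by simp
          also have "\<dots> = ((v - u) * (1 - \<theta>)) *\<^sub>R c1 + ((v - u) * \<theta>) *\<^sub>R c2" by (simp only: c \<theta>)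
          finally show ?thesis by (simp add: scaleR_add_right)
        qed
        ultimately show ?thesis by blast
      qed
    qed
  next
    case (local s)
    have "0 \<le> s" using local(1) ab by simp
    from trajectory_local[OF y this]
    obtain h where "0 < h" and h: "\<And>u v. 0 \<le> u \<Longrightarrow> u \<le> s \<Longrightarrow> s \<le> v \<Longrightarrow> v - u < h \<Longrightarrow>
      \<exists>w\<in>qvals (y s). y v - y u = (v - u) *\<^sub>R velocity w" by blast
    have "P u v" if "u \<le> s \<and> s \<le> v \<and> v - u < h" for u v
      unfolding P_def
    proof
      assume uv: "a \<le> u \<and> u \<le> v \<and> v \<le> b"
      have "\<exists>w\<in>qvals (y s). y v - y u = (v - u) *\<^sub>R velocity w"
        by (rule h) (use uv that ab in auto)
      then obtain w where "w \<in> qvals (y s)" "y v - y u = (v - u) *\<^sub>R velocity w" by blast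
      then show "\<exists>c\<in>C. y v - y u = (v - u) *\<^sub>R c" using C[of s] local by auto
    qed
    then show ?case using \<open>0 < h\<close> by blast
  qed
  then show ?thesis using ab by (simp add: P_def)
qed

lemma trajectory_continuous_on:
  assumes y: "trajectory y"
  shows "continuous_on {0..} y"
  unfolding continuous_on_iff
proof (intro ballI allI impI)
  fix t e :: real assume "t \<in> {0..}" "0 < e"
  then have "0 \<le> t" by simp
  from trajectory_local[OF assms this] obtain h where "0 < h"
    and h: "\<And>u v. 0 \<le> u \<Longrightarrow> u \<le> t \<Longrightarrow> t \<le> v \<Longrightarrow> v - u < h \<Longrightarrow>
      \<exists>w\<in>qvals (y t). y v - y u = (v - u) *\<^sub>R velocity w" by blast
  obtain M where "0 < M" and M: "\<And>w. w \<in> qvals (y t) \<Longrightarrow> norm (velocity w) \<le> M"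
    using compact_imp_bounded[OF compact_velocity_qvals[of "y t"]] unfolding bounded_pos by blast
  have "dist (y s) (y t) < e" if "s \<in> {0..}" "dist s t < min h (e / M)" for s
  proof -
    have "norm (y s - y t) \<le> \<bar>s - t\<bar> * M"
    proof (cases "s \<le> t")
      case True
      have "\<exists>w\<in>qvals (y t). y t - y s = (t - s) *\<^sub>R velocity w"
        by (rule h) (use True that in \<open>auto simp: dist_real_def\<close>)
      then obtain w where w: "w \<in> qvals (y t)" "y t - y s = (t - s) *\<^sub>R velocity w" by blast
      have "norm (y s - y t) = \<bar>s - t\<bar> * norm (velocity w)" 
        by (simp add: norm_minus_commute[of "y s"] w(2) abs_minus_commute)
      then show ?thesis using M[OF w(1)] by (simp add: mult_left_mono)
    next
      case False
      have "\<exists>w\<in>qvals (y t). y s - y t = (s - t) *\<^sub>R velocity w"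
        by (rule h) (use False that \<open>0 \<le> t\<close> in \<open>auto simp: dist_real_def\<close>)
      then obtain w where w: "w \<in> qvals (y t)" "y s - y t = (s - t) *\<^sub>R velocity w" by blast
      have "norm (y s - y t) = \<bar>s - t\<bar> * norm (velocity w)" by (simp add: w(2))
      then show ?thesis using M[OF w(1)] by (simp add: mult_left_mono)
    qed
    also have "\<dots> < e" using that \<open>0 < M\<close> by (simp add: dist_real_def pos_less_divide_eq)
    finally show ?thesis by (simp add: dist_norm)
  qed
  then show "\<exists>d>0. \<forall>s\<in>{0..}. dist s t < d \<longrightarrow> dist (y s) (y t) < e"
    using \<open>0 < h\<close> \<open>0 < M\<close> \<open>0 < e\<close> by (intro exI[of _ "min h (e / M)"]) auto
qed

text \<open>
  The constant depends only on the size of the trajectory, which makes time translates of a bounded trajectory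
  equicontinuous.
\<close>

lemma trajectory_lipschitz_bound:
  obtains B where "0 < B" "\<And>y a b. trajectory y \<Longrightarrow> 0 \<le> a \<Longrightarrow> (\<And>s. s \<in> {a..b} \<Longrightarrow> norm (y s) \<le> R) \<Longrightarrow> B-lipschitz_on {a..b} y"
proof -
  obtain M where "0 < M" and M: "\<And>w. norm (velocity w) \<le> M * norm w"
    using linear_bounded_pos[OF linear_velocity] by (metis mult.commute)
  define B where "B = M * (real CARD('n) * (\<bar>R\<bar> + \<Delta>))"
  have "0 < B" using \<open>0 < M\<close> \<Delta>_pos by (simp add: B_def add_nonneg_pos)
  have "B-lipschitz_on {a..b} y" if y: "trajectory y" and "0 \<le> a" and R: "\<And>s. s \<in> {a..b} \<Longrightarrow> norm (y s) \<le> R" for y a b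
  proof -
    have *: "norm (y v - y u) \<le> B * (v - u)" if "a \<le> u" "u \<le> v" "v \<le> b" for u v
    proof -
      have "\<exists>c\<in>cball 0 B. y v - y u = (v - u) *\<^sub>R c"
      proof (rule trajectory_increment_in_convex[OF y])
        show "velocity ` qvals (y s) \<subseteq> cball 0 B" if "s \<in> {u..v}" for s
        proof clarify
          fix w assume w: "w \<in> qvals (y s)"
          have "norm (y s) \<le> \<bar>R\<bar>" using R[of s] that \<open>a \<le> u\<close> \<open>v \<le> b\<close> by auto
          then have "norm w \<le> real CARD('n) * (\<bar>R\<bar> + \<Delta>)" using w by (rule qvals_bound)
          then have "M * norm w \<le> B" using \<open>0 < M\<close> by (simp add: B_def)
          then show "velocity w \<in> cball 0 B" using M[of w] by simp
        qed
      qed (use that \<open>0 \<le> a\<close> in auto)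
      then obtain c where c: "norm c \<le> B" "y v - y u = (v - u) *\<^sub>R c" by auto
      then show ?thesis using mult_right_mono[OF c(1), of "v - u"] that by (simp add: mult.commute)
    qed
    show ?thesis
    proof (rule lipschitz_onI)
      fix u v assume "u \<in> {a..b}" "v \<in> {a..b}"
      then show "dist (y u) (y v) \<le> B * dist u v"
        using *[of u v] *[of v u] by (cases "u \<le> v") (auto simp: dist_norm dist_real_def norm_minus_commute)
    qed (use \<open>0 < B\<close> in simp)
  qed
  then show thesis using that \<open>0 < B\<close> by blast
qed

lemma trajectory_lipschitz_on:
  assumes y: "trajectory y"
  obtains B where "0 < B" "B-lipschitz_on {0..b} y"
proof -
  have "compact (y ` {0..b})"
    by (intro compact_continuous_image continuous_on_subset[OF trajectory_continuous_on[OF y]]) auto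
  then have "bounded (y ` {0..b})" by (rule compact_imp_bounded)
  then obtain R where R: "\<And>s. s \<in> {0..b} \<Longrightarrow> norm (y s) \<le> R"
    unfolding bounded_iff by blast
  obtain B where "0 < B" "\<And>y a b. trajectory y \<Longrightarrow> 0 \<le> a \<Longrightarrow> (\<And>s. s \<in> {a..b} \<Longrightarrow> norm (y s) \<le> R) \<Longrightarrow> B-lipschitz_on {a..b} y"
    using trajectory_lipschitz_bound[of R] by blast
  then show thesis using that y R by blast
qed

lemma trajectory_coordinate_lipschitz:
  assumes y: "trajectory y"
  obtains B where "0 < B" "\<And>u v i. u \<in> {0..b} \<Longrightarrow> v \<in> {0..b} \<Longrightarrow> \<bar>y u $ i - y v $ i\<bar> \<le> B * dist u v"
proof -
  obtain B where "0 < B" and B: "B-lipschitz_on {0..b} y" using trajectory_lipschitz_on[OF y] by blast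
  have "\<bar>y u $ i - y v $ i\<bar> \<le> B * dist u v" if "u \<in> {0..b}" "v \<in> {0..b}" for u v i
  proof -
    have "\<bar>y u $ i - y v $ i\<bar> \<le> norm (y u - y v)" using component_le_norm_cart[of "y u - y v" i] by simp
    also have "\<dots> \<le> B * dist u v" using lipschitz_onD[OF B that] by (simp add: dist_norm)
    finally show ?thesis .
  qed
  then show thesis using that \<open>0 < B\<close> by blast
qed

text \<open>
  Compactness of the time translates: a diagonal subsequence converges at rational times and, by
  equicontinuity, at all times. For the limit, near \<open>t\<close> the translates eventually stay where \<open>qvals\<close> is contained in
  \<open>qvals (z t)\<close>, so their mean velocities lie in a fixed compact set.
\<close>

lemma limit_trajectory:
  assumes y: "trajectory y" and R: "\<And>t. 0 \<le> t \<Longrightarrow> norm (y t) \<le> R"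
  obtains \<kappa> z where "strict_mono (\<kappa> :: nat \<Rightarrow> nat)" "trajectory z"
    "\<And>s. 0 \<le> s \<Longrightarrow> (\<lambda>n. y (real (\<kappa> n) + s)) \<longlonglongrightarrow> z s"
proof -
  obtain B where "0 < B" and B: "\<And>y a b. trajectory y \<Longrightarrow> 0 \<le> a \<Longrightarrow> (\<And>s. s \<in> {a..b} \<Longrightarrow> norm (y s) \<le> R) \<Longrightarrow> B-lipschitz_on {a..b} y"
    using trajectory_lipschitz_bound[of R] by blast
  have lip: "norm (y u - y v) \<le> B * \<bar>u - v\<bar>" if "0 \<le> u" "0 \<le> v" for u v
  proof -
    have "B-lipschitz_on {0..max u v} y" using B[OF y, of 0 "max u v"] R by simp
    then have "dist (y u) (y v) \<le> B * dist u v" using that by (intro lipschitz_onD) auto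
    then show ?thesis by (simp add: dist_norm)
  qed
  have "countable (\<rat> \<inter> {0::real..})" using countable_rat by (rule countable_subset[rotated]) (rule Int_lower1)
  then obtain \<kappa> where \<kappa>: "strict_mono (\<kappa> :: nat \<Rightarrow> nat)"
    "\<And>q. q \<in> \<rat> \<inter> {0..} \<Longrightarrow> \<exists>l. (\<lambda>n. y (real (\<kappa> n) + q)) \<longlonglongrightarrow> l"
  proof (rule function_convergent_subsequence[where f = "\<lambda>n q. y (real n + q)" and M = R])
    show "norm (y (real n + q)) \<le> R" if "q \<in> \<rat> \<inter> {0..}" for n q using that by (intro R) auto
  qed (rule that)
  have "\<exists>l. (\<lambda>n. y (real (\<kappa> n) + s)) \<longlonglongrightarrow> l" if "0 \<le> s" for s
  proof -
    have "Cauchy (\<lambda>n. y (real (\<kappa> n) + s))"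
    proof (rule metric_CauchyI)
      fix e :: real assume "0 < e"
      then have "s < s + e / (3 * B)" using \<open>0 < B\<close> by simp
      then obtain q where q: "q \<in> \<rat>" "s < q" "q < s + e / (3 * B)" using Rats_dense_in_real by blast
      have near: "dist (y (real (\<kappa> n) + s)) (y (real (\<kappa> n) + q)) < e / 3" for n
      proof -
        have "dist (y (real (\<kappa> n) + s)) (y (real (\<kappa> n) + q)) \<le> B * \<bar>s - q\<bar>"
          using lip[of "real (\<kappa> n) + s" "real (\<kappa> n) + q"] \<open>0 \<le> s\<close> q by (simp add: dist_norm)
        also have "\<dots> < e / 3" using q \<open>0 < B\<close> by (simp add: field_simps)
        finally show ?thesis .
      qed
      have "Cauchy (\<lambda>n. y (real (\<kappa> n) + q))"
        using \<kappa>(2)[of q] q \<open>0 \<le> s\<close> LIMSEQ_imp_Cauchy by auto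
      then obtain N where N: "\<And>m n. N \<le> m \<Longrightarrow> N \<le> n \<Longrightarrow> dist (y (real (\<kappa> m) + q)) (y (real (\<kappa> n) + q)) < e / 3"
        using metric_CauchyD[of "\<lambda>n. y (real (\<kappa> n) + q)" "e / 3"] \<open>0 < e\<close> by auto
      have "dist (y (real (\<kappa> m) + s)) (y (real (\<kappa> n) + s)) < e" if "N \<le> m" "N \<le> n" for m n
      proof -
        have "dist (y (real (\<kappa> m) + s)) (y (real (\<kappa> n) + s))
          \<le> dist (y (real (\<kappa> m) + s)) (y (real (\<kappa> m) + q)) + dist (y (real (\<kappa> m) + q)) (y (real (\<kappa> n) + q))
            + dist (y (real (\<kappa> n) + q)) (y (real (\<kappa> n) + s))"
          using dist_triangle[of "y (real (\<kappa> m) + s)" "y (real (\<kappa> n) + s)" "y (real (\<kappa> m) + q)"]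
            dist_triangle[of "y (real (\<kappa> m) + q)" "y (real (\<kappa> n) + s)" "y (real (\<kappa> n) + q)"] by linarith
        also have "\<dots> < e" using near[of m] near[of n] N[OF that] by (simp add: dist_commute)
        finally show ?thesis .
      qed
      then show "\<exists>N. \<forall>m\<ge>N. \<forall>n\<ge>N. dist (y (real (\<kappa> m) + s)) (y (real (\<kappa> n) + s)) < e" by blast
    qed
    then show ?thesis using Cauchy_convergent convergent_def by blast
  qed
  then obtain z where z: "\<And>s. 0 \<le> s \<Longrightarrow> (\<lambda>n. y (real (\<kappa> n) + s)) \<longlonglongrightarrow> z s" by metis
  have "trajectory z" unfolding trajectory_def
  proof (intro allI impI)
    fix t :: real assume "0 \<le> t"
    obtain \<epsilon> where \<epsilon>: "0 < \<epsilon>" "\<And>y'. norm (y' - z t) < \<epsilon> \<Longrightarrow> qvals y' \<subseteq> qvals (z t)" using qvals_usc by blast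
    \<comment> \<open>Half of \<open>\<epsilon>\<close> is spent on the motion within the interval, half on the distance to the limit.\<close>
    define h where "h = \<epsilon> / (2 * B)"
    have "0 < h" using \<epsilon> \<open>0 < B\<close> by (simp add: h_def)
    have "\<exists>w\<in>qvals (z t). z v - z u = (v - u) *\<^sub>R velocity w"
      if uv: "0 \<le> u" "u \<le> t" "t \<le> v" "v - u < h" for u v
    proof (cases "u = v")
      case True
      then show ?thesis using velocity_qvals_nonempty[of "z t"] by auto
    next
      case False
      have "\<forall>\<^sub>F n in sequentially. dist (y (real (\<kappa> n) + t)) (z t) < \<epsilon> / 2"
        using z[OF \<open>0 \<le> t\<close>] \<epsilon>(1) by (intro tendstoD) auto
      then have ev: "\<forall>\<^sub>F n in sequentially. (y (real (\<kappa> n) + v) - y (real (\<kappa> n) + u)) /\<^sub>R (v - u) \<in> velocity ` qvals (z t)"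
      proof (rule eventually_mono)
        fix n assume n: "dist (y (real (\<kappa> n) + t)) (z t) < \<epsilon> / 2"
        have "\<exists>c\<in>velocity ` qvals (z t). y (real (\<kappa> n) + v) - y (real (\<kappa> n) + u) = ((real (\<kappa> n) + v) - (real (\<kappa> n) + u)) *\<^sub>R c"
        proof (rule trajectory_increment_in_convex[OF y _ _ convex_velocity_qvals])
          fix s assume s: "s \<in> {real (\<kappa> n) + u..real (\<kappa> n) + v}"
          have "norm (y s - y (real (\<kappa> n) + t)) \<le> B * \<bar>s - (real (\<kappa> n) + t)\<bar>" using s uv \<open>0 \<le> t\<close> by (intro lip) auto
          also have "\<dots> \<le> B * (v - u)" using s uv \<open>0 < B\<close> by (intro mult_left_mono) auto
          also have "\<dots> < B * h" using uv \<open>0 < B\<close> by simp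
          also have "\<dots> = \<epsilon> / 2" using \<open>0 < B\<close> by (simp add: h_def)
          finally have "norm (y s - z t) < \<epsilon>"
            using n norm_triangle_ineq[of "y s - y (real (\<kappa> n) + t)" "y (real (\<kappa> n) + t) - z t"] by (simp add: dist_norm)
          then show "velocity ` qvals (y s) \<subseteq> velocity ` qvals (z t)" using \<epsilon>(2) by blast
        qed (use uv in auto)
        then show "(y (real (\<kappa> n) + v) - y (real (\<kappa> n) + u)) /\<^sub>R (v - u) \<in> velocity ` qvals (z t)"
          using False by auto
      qed
      have "(\<lambda>n. (y (real (\<kappa> n) + v) - y (real (\<kappa> n) + u)) /\<^sub>R (v - u)) \<longlonglongrightarrow> (z v - z u) /\<^sub>R (v - u)"
        using uv by (intro tendsto_intros z) auto
      then have "(z v - z u) /\<^sub>R (v - u) \<in> velocity ` qvals (z t)"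
        using Lim_in_closed_set[OF compact_imp_closed[OF compact_velocity_qvals] ev] by simp
      then obtain w where w: "w \<in> qvals (z t)" "(z v - z u) /\<^sub>R (v - u) = velocity w" by blast
      have "z v - z u = (v - u) *\<^sub>R velocity w" using False by (simp flip: w(2))
      then show ?thesis using w(1) by blast
    qed
    then show "\<exists>h>0. \<forall>u v. 0 \<le> u \<and> u \<le> t \<and> t \<le> v \<and> v - u < h \<longrightarrow> (\<exists>w\<in>qvals (z t). z v - z u = (v - u) *\<^sub>R velocity w)"
      using \<open>0 < h\<close> by blast
  qed
  with \<kappa>(1) z show thesis by (rule_tac that)
qed

section \<open>Velocities at almost every time\<close>

text \<open>
  The values \<open>w\<close> that can produce the motion at position \<open>p\<close> at almost every time: coordinates that agree
  move together, and a coordinate at one of the finitely many distinguished levels in \<open>C\<close> is at rest.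
\<close>

definition admissible :: "real set \<Rightarrow> real^'n \<Rightarrow> real^'n \<Rightarrow> bool" where
  "admissible C p w \<longleftrightarrow> w \<in> qvals p \<and> (\<forall>i j. p $ i = p $ j \<longrightarrow> velocity w $ i = velocity w $ j) \<and>
     (\<forall>i. p $ i \<in> C \<longrightarrow> velocity w $ i = 0)"

text \<open>
  The times at which differences of coinciding coordinates, and distances to the levels attained, vanish to
  first order.
\<close>

definition regular_time :: "real set \<Rightarrow> (real \<Rightarrow> real^'n) \<Rightarrow> real \<Rightarrow> real \<Rightarrow> bool" where
  "regular_time C y T t \<longleftrightarrow>
     (\<forall>i j. y t $ i - y t $ j = 0 \<longrightarrow>
        (\<forall>e>0. \<exists>d>0. \<forall>s\<in>{0..T}. \<bar>s - t\<bar> < d \<longrightarrow> \<bar>y s $ i - y s $ j\<bar> \<le> e * \<bar>s - t\<bar>)) \<and>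
     (\<forall>i. \<forall>c\<in>C. y t $ i - c = 0 \<longrightarrow>
        (\<forall>e>0. \<exists>d>0. \<forall>s\<in>{0..T}. \<bar>s - t\<bar> < d \<longrightarrow> \<bar>y s $ i - c\<bar> \<le> e * \<bar>s - t\<bar>))"

lemma AE_regular_time:
  assumes y: "trajectory y" and "finite C" and "0 \<le> T"
  shows "AE t in lebesgue. t \<in> {0..T} \<longrightarrow> regular_time C y T t"
proof -
  obtain B where "0 < B" and Bi: "\<And>u v i. u \<in> {0..T} \<Longrightarrow> v \<in> {0..T} \<Longrightarrow> \<bar>y u $ i - y v $ i\<bar> \<le> B * dist u v"
    using trajectory_coordinate_lipschitz[OF y, of T] by metis
  have "AE t in lebesgue. t \<in> {0..T} \<longrightarrow> y t $ i - y t $ j = 0 \<longrightarrow>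
      (\<forall>e>0. \<exists>d>0. \<forall>s\<in>{0..T}. \<bar>s - t\<bar> < d \<longrightarrow> \<bar>y s $ i - y s $ j\<bar> \<le> e * \<bar>s - t\<bar>)" for i j
  proof (rule lipschitz_zero_set_flat_interval[where h = "\<lambda>s. y s $ i - y s $ j" and L = "2 * B", OF _ \<open>0 \<le> T\<close>])
    show "(2 * B)-lipschitz_on {0..T} (\<lambda>s. y s $ i - y s $ j)"
    proof (rule lipschitz_onI)
      fix u v assume uv: "u \<in> {0..T}" "v \<in> {0..T}"
      show "dist (y u $ i - y u $ j) (y v $ i - y v $ j) \<le> 2 * B * dist u v"
        using Bi[OF uv, of i] Bi[OF uv, of j] unfolding dist_real_def[of "_ - _"] by linarith
    qed (use \<open>0 < B\<close> in simp)
  qed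
  moreover have "AE t in lebesgue. t \<in> {0..T} \<longrightarrow> y t $ i - c = 0 \<longrightarrow>
      (\<forall>e>0. \<exists>d>0. \<forall>s\<in>{0..T}. \<bar>s - t\<bar> < d \<longrightarrow> \<bar>y s $ i - c\<bar> \<le> e * \<bar>s - t\<bar>)" for i c
  proof (rule lipschitz_zero_set_flat_interval[where h = "\<lambda>s. y s $ i - c" and L = B, OF _ \<open>0 \<le> T\<close>])
    show "B-lipschitz_on {0..T} (\<lambda>s. y s $ i - c)"
    proof (rule lipschitz_onI)
      fix u v assume uv: "u \<in> {0..T}" "v \<in> {0..T}"
      show "dist (y u $ i - c) (y v $ i - c) \<le> B * dist u v"
        using Bi[OF uv, of i] unfolding dist_real_def[of "_ - _"] by simp
    qed (use \<open>0 < B\<close> in simp)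
  qed
  ultimately have "AE t in lebesgue.
      (\<forall>i\<in>UNIV. \<forall>j\<in>UNIV. t \<in> {0..T} \<longrightarrow> y t $ i - y t $ j = 0 \<longrightarrow>
        (\<forall>e>0. \<exists>d>0. \<forall>s\<in>{0..T}. \<bar>s - t\<bar> < d \<longrightarrow> \<bar>y s $ i - y s $ j\<bar> \<le> e * \<bar>s - t\<bar>)) \<and>
      (\<forall>i\<in>UNIV. \<forall>c\<in>C. t \<in> {0..T} \<longrightarrow> y t $ i - c = 0 \<longrightarrow>
        (\<forall>e>0. \<exists>d>0. \<forall>s\<in>{0..T}. \<bar>s - t\<bar> < d \<longrightarrow> \<bar>y s $ i - c\<bar> \<le> e * \<bar>s - t\<bar>))"
    using \<open>finite C\<close> by (intro AE_conjI AE_finite_allI) auto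
  then show ?thesis
    by (rule AE_mp) (intro AE_I2 impI, unfold regular_time_def, simp)
qed

text \<open>
  Mean velocities over shrinking intervals around a regular time have limit points by compactness of \<open>qvals\<close>,
  and regularity forces every limit point to be admissible. This replaces the derivative at
  \<open>t\<close>.
\<close>

lemma regular_time_limit_velocity:
  assumes y: "trajectory y" and reg: "regular_time C y T t" and "0 \<le> t"
    and uv: "\<And>n. 0 \<le> u n" "\<And>n. u n \<le> t" "\<And>n. t \<le> v n" "\<And>n. v n \<le> T" "\<And>n. u n < v n"
    and lim: "(\<lambda>n. v n - u n) \<longlonglongrightarrow> 0"
  obtains \<phi> w where "strict_mono (\<phi> :: nat \<Rightarrow> nat)" "admissible C (y t) w"
    "(\<lambda>n. (y (v (\<phi> n)) - y (u (\<phi> n))) /\<^sub>R (v (\<phi> n) - u (\<phi> n))) \<longlonglongrightarrow> velocity w"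
proof -
  define q where "q n = (y (v n) - y (u n)) /\<^sub>R (v n - u n)" for n
  from trajectory_local[OF y \<open>0 \<le> t\<close>] obtain h where "0 < h"
    and h: "\<And>u v. 0 \<le> u \<Longrightarrow> u \<le> t \<Longrightarrow> t \<le> v \<Longrightarrow> v - u < h \<Longrightarrow>
      \<exists>w\<in>qvals (y t). y v - y u = (v - u) *\<^sub>R velocity w" by blast
  have small: "\<forall>\<^sub>F n in sequentially. v n - u n < d" if "0 < d" for d
    using order_tendstoD(2)[OF lim that] .
  from small[OF \<open>0 < h\<close>] obtain N where N: "\<And>n. N \<le> n \<Longrightarrow> v n - u n < h"
    unfolding eventually_sequentially by blast
  have "\<exists>w\<in>qvals (y t). q (n + N) = velocity w" for n
  proof -
    have "\<exists>w\<in>qvals (y t). y (v (n + N)) - y (u (n + N)) = (v (n + N) - u (n + N)) *\<^sub>R velocity w"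
      by (rule h[OF uv(1-3) N]) simp
    then obtain w where "w \<in> qvals (y t)" "y (v (n + N)) - y (u (n + N)) = (v (n + N) - u (n + N)) *\<^sub>R velocity w" by blast
    then have "q (n + N) = velocity w" using uv(5)[of "n + N"] by (simp add: q_def)
    then show ?thesis using \<open>w \<in> qvals (y t)\<close> by blast
  qed
  then obtain W where W: "\<And>n. W n \<in> qvals (y t)" "\<And>n. q (n + N) = velocity (W n)" by metis
  obtain w \<psi> where w: "w \<in> qvals (y t)" and "strict_mono (\<psi> :: nat \<Rightarrow> nat)" and lw: "(W \<circ> \<psi>) \<longlonglongrightarrow> w"
    using compact_qvals[of "y t"] W(1) unfolding compact_def by blast
  define \<phi> where "\<phi> n = \<psi> n + N" for n
  have "strict_mono \<phi>" using \<open>strict_mono \<psi>\<close> by (simp add: \<phi>_def strict_mono_def)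
  have "bounded_linear velocity" using linear_velocity linear_conv_bounded_linear by blast
  then have lq: "(\<lambda>n. q (\<phi> n)) \<longlonglongrightarrow> velocity w"
    using bounded_linear.tendsto[OF _ lw, of velocity] by (simp add: \<phi>_def W(2) o_def)
  have flat: "L = 0" if g: "\<And>e. 0 < e \<Longrightarrow> \<exists>d>0. \<forall>s\<in>{0..T}. \<bar>s - t\<bar> < d \<longrightarrow> \<bar>g s\<bar> \<le> e * \<bar>s - t\<bar>"
    and L: "(\<lambda>n. (g (v (\<phi> n)) - g (u (\<phi> n))) / (v (\<phi> n) - u (\<phi> n))) \<longlonglongrightarrow> L" for g :: "real \<Rightarrow> real" and L
  proof -
    have "\<bar>L\<bar> \<le> 0 + e" if "0 < e" for e
    proof -
      obtain d where "0 < d" and d: "\<And>s. s \<in> {0..T} \<Longrightarrow> \<bar>s - t\<bar> < d \<Longrightarrow> \<bar>g s\<bar> \<le> e * \<bar>s - t\<bar>"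
        using g[OF \<open>0 < e\<close>] by blast
      have "\<forall>\<^sub>F n in sequentially. v (\<phi> n) - u (\<phi> n) < d"
        using eventually_subseq[OF \<open>strict_mono \<phi>\<close> small[OF \<open>0 < d\<close>]] .
      then have "\<forall>\<^sub>F n in sequentially. \<bar>(g (v (\<phi> n)) - g (u (\<phi> n))) / (v (\<phi> n) - u (\<phi> n))\<bar> \<le> e"
      proof (rule eventually_mono)
        fix n assume n: "v (\<phi> n) - u (\<phi> n) < d"
        have "\<bar>g (v (\<phi> n))\<bar> \<le> e * (v (\<phi> n) - t)" "\<bar>g (u (\<phi> n))\<bar> \<le> e * (t - u (\<phi> n))"
          using d[of "v (\<phi> n)"] d[of "u (\<phi> n)"] uv(1-4)[of "\<phi> n"] n \<open>0 \<le> t\<close> by auto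
        then have "\<bar>g (v (\<phi> n)) - g (u (\<phi> n))\<bar> \<le> e * (v (\<phi> n) - t) + e * (t - u (\<phi> n))" by linarith
        also have "\<dots> = e * (v (\<phi> n) - u (\<phi> n))" by (simp add: algebra_simps)
        finally show "\<bar>(g (v (\<phi> n)) - g (u (\<phi> n))) / (v (\<phi> n) - u (\<phi> n))\<bar> \<le> e"
          using uv(5)[of "\<phi> n"] by (simp add: abs_divide pos_divide_le_eq)
      qed
      then show ?thesis using tendsto_upperbound[OF tendsto_rabs[OF L]] by simp
    qed
    then have "\<bar>L\<bar> \<le> 0" by (rule field_le_epsilon)
    then show ?thesis by simp
  qed
  have qi: "(\<lambda>n. (y (v (\<phi> n)) $ i - y (u (\<phi> n)) $ i) / (v (\<phi> n) - u (\<phi> n))) \<longlonglongrightarrow> velocity w $ i" for i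
    using tendsto_vec_nth[OF lq, of i] by (simp add: q_def divide_inverse mult.commute)
  have "admissible C (y t) w" unfolding admissible_def
  proof (intro conjI allI impI)
    show "w \<in> qvals (y t)" by fact
    fix i j assume "y t $ i = y t $ j"
    have "velocity w $ i - velocity w $ j = 0"
    proof (rule flat)
      show "\<exists>d>0. \<forall>s\<in>{0..T}. \<bar>s - t\<bar> < d \<longrightarrow> \<bar>y s $ i - y s $ j\<bar> \<le> e * \<bar>s - t\<bar>" if "0 < e" for e
        using reg that \<open>y t $ i = y t $ j\<close> unfolding regular_time_def by simp
      show "(\<lambda>n. ((y (v (\<phi> n)) $ i - y (v (\<phi> n)) $ j) - (y (u (\<phi> n)) $ i - y (u (\<phi> n)) $ j)) / (v (\<phi> n) - u (\<phi> n)))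
          \<longlonglongrightarrow> velocity w $ i - velocity w $ j"
        using tendsto_diff[OF qi[of i] qi[of j]] by (simp add: diff_divide_distrib add_divide_distrib algebra_simps)
    qed
    then show "velocity w $ i = velocity w $ j" by simp
  next
    fix i assume "y t $ i \<in> C"
    show "velocity w $ i = 0"
    proof (rule flat)
      show "\<exists>d>0. \<forall>s\<in>{0..T}. \<bar>s - t\<bar> < d \<longrightarrow> \<bar>y s $ i - y t $ i\<bar> \<le> e * \<bar>s - t\<bar>" if "0 < e" for e
        using reg that \<open>y t $ i \<in> C\<close> unfolding regular_time_def by simp
      show "(\<lambda>n. ((y (v (\<phi> n)) $ i - y t $ i) - (y (u (\<phi> n)) $ i - y t $ i)) / (v (\<phi> n) - u (\<phi> n))) \<longlonglongrightarrow> velocity w $ i"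
        using qi[of i] by simp
    qed
  qed
  then show thesis using that[OF \<open>strict_mono \<phi>\<close>] lq by (simp add: q_def)
qed

lemma admissible_exists:
  assumes y: "trajectory y" and "finite C"
  obtains t w where "0 \<le> t" "admissible C (y t) w"
proof -
  have "\<exists>t\<in>{0..<1}. regular_time C y 1 t"
  proof (rule ccontr)
    assume "\<not> ?thesis"
    then have no: "\<not> regular_time C y 1 t" if "t \<in> {0..<1}" for t using that by blast
    have "AE t in lebesgue. t \<in> {0..1} \<longrightarrow> regular_time C y 1 t"
      by (rule AE_regular_time[OF y \<open>finite C\<close>]) simp
    then have "AE t in lebesgue. t \<notin> {0..<1::real}"
    proof (rule AE_mp, intro AE_I2 impI notI)
      fix t :: real assume "t \<in> {0..1} \<longrightarrow> regular_time C y 1 t" "t \<in> {0..<1}"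
      then show False using no[of t] by simp
    qed
    then have "{0..<1::real} \<in> null_sets lebesgue" by (subst AE_iff_null_sets) auto
    then show False by (simp add: null_sets_def)
  qed
  then obtain t where t: "0 \<le> t" "t < 1" "regular_time C y 1 t" by auto
  have "(\<lambda>n. t + (1 - t) * (1 / real (Suc n)) - t) \<longlonglongrightarrow> t + (1 - t) * 0 - t"
    by (intro tendsto_intros LIMSEQ_Suc[OF lim_1_over_n])
  then have lim: "(\<lambda>n. t + (1 - t) * (1 / real (Suc n)) - t) \<longlonglongrightarrow> 0" by simp
  have "t + (1 - t) * (1 / real (Suc n)) \<le> 1" for n
    using mult_left_le[of "1 / real (Suc n)" "1 - t"] t by simp
  then obtain \<phi> w where "admissible C (y t) w"
    by (rule_tac regular_time_limit_velocity[OF y t(3,1), of "\<lambda>_. t" "\<lambda>n. t + (1 - t) * (1 / real (Suc n))", OF _ _ _ _ _ lim])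
      (use t in auto)
  then show thesis using that t(1) by blast
qed

text \<open>
  The function \<open>max c (max\<^sub>i y\<^sub>i)\<close>, over \<open>i\<close> in \<open>I\<close>, is nonincreasing if, whenever it exceeds \<open>c\<close>, some coordinate
  attaining it does not move up. One such coordinate suffices since at a regular time all coordinates attaining the
  maximum have the same velocity, and since those at level \<open>c\<close> are at rest. Otherwise, at some regular time, the
  function would grow at a rate \<open>e\<close> over intervals shrinking to that time, and their limit velocity
  would be positive at a coordinate attaining the maximum.
\<close>

lemma level_not_crossed:
  assumes y: "trajectory y" and C: "finite C" "c \<in> C"
    and step: "\<And>t w m. 0 \<le> t \<Longrightarrow> admissible C (y t) w \<Longrightarrow> c < m \<Longrightarrow> (\<And>i. i \<in> I \<Longrightarrow> y t $ i \<le> m) \<Longrightarrow>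
      \<exists>i\<in>I. y t $ i = m \<Longrightarrow> \<exists>k\<in>I. y t $ k = m \<and> velocity w $ k \<le> 0"
    and st: "0 \<le> s" "s \<le> t" and m0: "c \<le> m0" "\<And>i. i \<in> I \<Longrightarrow> y s $ i \<le> m0"
    and "i0 \<in> I"
  shows "y t $ i0 \<le> m0"
proof -
  define f where "f \<tau> = Max (insert c ((\<lambda>i. y \<tau> $ i) ` I))" for \<tau>
  have fin: "finite (insert c ((\<lambda>i. y \<tau> $ i) ` I))" for \<tau> by simp
  have f_c: "c \<le> f \<tau>" and f_i: "\<And>i. i \<in> I \<Longrightarrow> y \<tau> $ i \<le> f \<tau>" for \<tau>
    unfolding f_def by (auto intro: Max_ge)
  have f_cases: "f \<tau> = c \<or> (\<exists>i\<in>I. f \<tau> = y \<tau> $ i)" for \<tau>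
    using Max_in[OF fin[of \<tau>]] unfolding f_def by auto
  obtain B where "0 < B" and Bi: "\<And>u v i. u \<in> {0..t} \<Longrightarrow> v \<in> {0..t} \<Longrightarrow> \<bar>y u $ i - y v $ i\<bar> \<le> B * dist u v"
    using trajectory_coordinate_lipschitz[OF y, of t] by metis
  have fL: "f u \<le> f v + B * dist u v" if "u \<in> {0..t}" "v \<in> {0..t}" for u v
  proof -
    have "0 \<le> B * dist u v" using \<open>0 < B\<close> by simp
    consider "f u = c" | i where "i \<in> I" "f u = y u $ i" using f_cases by blast
    then show ?thesis
    proof cases
      case 1
      then show ?thesis using f_c[of v] \<open>0 \<le> B * dist u v\<close> by linarith
    next
      case 2
      then show ?thesis using f_i[OF 2(1), of v] Bi[OF that, of i] by linarith
    qed
  qed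
  have lipf: "B-lipschitz_on {0..t} f"
  proof (rule lipschitz_onI)
    show "dist (f u) (f v) \<le> B * dist u v" if "u \<in> {0..t}" "v \<in> {0..t}" for u v
      using fL[OF that] fL[OF that(2,1)] unfolding dist_real_def[of "f u"] dist_commute[of v] by linarith
  qed (use \<open>0 < B\<close> in simp)
  have "f t \<le> f s"
  proof (rule abs_continuous_on_nonincreasing[OF _ st(2)])
    show "abs_continuous_on {s..t} f"
      using lipschitz_imp_abs_continuous_on[OF lipschitz_on_subset[OF lipf]] st by auto
    have "AE \<tau> in lebesgue. \<tau> \<in> {0..t} \<longrightarrow> regular_time C y t \<tau>"
      using AE_regular_time[OF y C(1)] st by simp
    then show "AE \<tau> in lebesgue. \<tau> \<in> {s..t} \<longrightarrow> (\<forall>e>0. \<exists>d>0. \<forall>u v. s \<le> u \<and> u \<le> \<tau> \<and> \<tau> \<le> v \<and> v \<le> t \<and> v - u < d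
        \<longrightarrow> f v - f u \<le> e * (v - u))"
    proof (rule AE_mp, intro AE_I2 impI allI)
      fix \<tau> e :: real
      assume "\<tau> \<in> {0..t} \<longrightarrow> regular_time C y t \<tau>" and \<tau>: "\<tau> \<in> {s..t}" and "0 < e"
      then have reg: "regular_time C y t \<tau>" and "0 \<le> \<tau>" using st by auto
      show "\<exists>d>0. \<forall>u v. s \<le> u \<and> u \<le> \<tau> \<and> \<tau> \<le> v \<and> v \<le> t \<and> v - u < d \<longrightarrow> f v - f u \<le> e * (v - u)"
      proof (rule ccontr)
        assume neg: "\<not> ?thesis"
        have "\<exists>u v. s \<le> u \<and> u \<le> \<tau> \<and> \<tau> \<le> v \<and> v \<le> t \<and> v - u < 1 / real (Suc n) \<and> e * (v - u) < f v - f u" for n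
        proof -
          have "0 < 1 / real (Suc n)" by simp
          with neg show ?thesis unfolding not_le[symmetric] by blast
        qed
        then obtain u v where uv: "\<And>n. s \<le> u n" "\<And>n. u n \<le> \<tau>" "\<And>n. \<tau> \<le> v n" "\<And>n. v n \<le> t"
          "\<And>n. v n - u n < 1 / real (Suc n)" "\<And>n. e * (v n - u n) < f (v n) - f (u n)"
          by metis
        have u0: "0 \<le> u n" for n using uv(1)[of n] st by simp
        have less: "u n < v n" for n
        proof (rule ccontr)
          assume "\<not> u n < v n"
          then have "u n = v n" using uv(2,3)[of n] by simp
          then show False using uv(6)[of n] by simp
        qed
        have lim: "(\<lambda>n. v n - u n) \<longlonglongrightarrow> 0"
        proof (rule tendsto_sandwich[of "\<lambda>_. 0" _ _ "\<lambda>n. 1 / real (Suc n)"])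
          show "(\<lambda>n. 1 / real (Suc n)) \<longlonglongrightarrow> 0" by (rule LIMSEQ_Suc[OF lim_1_over_n])
        qed (use less uv(5) in \<open>auto intro!: always_eventually less_imp_le\<close>)
        obtain \<phi> w where \<phi>: "strict_mono (\<phi> :: nat \<Rightarrow> nat)" and w: "admissible C (y \<tau>) w"
          and lw: "(\<lambda>n. (y (v (\<phi> n)) - y (u (\<phi> n))) /\<^sub>R (v (\<phi> n) - u (\<phi> n))) \<longlonglongrightarrow> velocity w"
          using regular_time_limit_velocity[OF y reg \<open>0 \<le> \<tau>\<close> u0 uv(2-4) less lim] by blast
        \<comment> \<open>Every coordinate attaining the maximum at \<open>\<tau>\<close> inherits the sign from the one supplied by \<open>step\<close>, or is at level \<open>c\<close>.\<close>
        have top: "velocity w $ i \<le> 0" if "i \<in> I" "y \<tau> $ i = f \<tau>" for i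
        proof (cases "c < f \<tau>")
          case True
          have "\<exists>k\<in>I. y \<tau> $ k = f \<tau> \<and> velocity w $ k \<le> 0"
            by (rule step[OF \<open>0 \<le> \<tau>\<close> w True]) (use f_i that in auto)
          then obtain k where "k \<in> I" "y \<tau> $ k = f \<tau>" "velocity w $ k \<le> 0" by blast
          moreover have "velocity w $ i = velocity w $ k"
            using w that(2) calculation(2) unfolding admissible_def by (elim conjE allE[of _ i] allE[of _ k]) simp
          ultimately show ?thesis by simp
        next
          case False
          then have "y \<tau> $ i \<in> C" using f_c[of \<tau>] that C(2) by simp
          then have "velocity w $ i = 0" using w unfolding admissible_def by blast
          then show ?thesis by simp
        qed
        have "(\<lambda>n. v (\<phi> n) - u (\<phi> n)) \<longlonglongrightarrow> 0"
          using filterlim_compose[OF lim filterlim_subseq[OF \<phi>]] .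
        from tendsto_add[OF tendsto_const this, of \<tau>]
        have lim': "(\<lambda>n. \<tau> + (v (\<phi> n) - u (\<phi> n))) \<longlonglongrightarrow> \<tau>" by simp
        have lv: "(\<lambda>n. v (\<phi> n)) \<longlonglongrightarrow> \<tau>"
        proof (rule tendsto_sandwich[OF _ _ tendsto_const lim'])
          show "\<forall>\<^sub>F n in sequentially. \<tau> \<le> v (\<phi> n)" by (intro always_eventually allI uv(3))
          have "v (\<phi> n) \<le> \<tau> + (v (\<phi> n) - u (\<phi> n))" for n using uv(2)[of "\<phi> n"] by linarith
          then show "\<forall>\<^sub>F n in sequentially. v (\<phi> n) \<le> \<tau> + (v (\<phi> n) - u (\<phi> n))"
            by (intro always_eventually allI)
        qed
        have contf: "continuous_on {0..t} f" by (rule lipschitz_on_continuous_on[OF lipf])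
        have conty: "continuous_on {0..t} y"
          by (rule continuous_on_subset[OF trajectory_continuous_on[OF y]]) auto
        have tau: "\<tau> \<in> {0..t}" and vin: "\<And>n. v (\<phi> n) \<in> {0..t}" using \<tau> st uv(3,4) \<open>0 \<le> \<tau>\<close> by (auto intro: order_trans)
        have lf: "(\<lambda>n. f (v (\<phi> n))) \<longlonglongrightarrow> f \<tau>"
          by (rule continuous_on_tendsto_compose[OF contf lv tau]) (use vin in auto)
        have ly: "(\<lambda>n. y (v (\<phi> n))) \<longlonglongrightarrow> y \<tau>"
          by (rule continuous_on_tendsto_compose[OF conty lv tau]) (use vin in auto)
        have "\<forall>\<^sub>F n in sequentially. f (v (\<phi> n)) \<noteq> y (v (\<phi> n)) $ i \<or>
            f (v (\<phi> n)) - f (u (\<phi> n)) \<le> e * (v (\<phi> n) - u (\<phi> n))" if "i \<in> I" for i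
        proof (cases "y \<tau> $ i = f \<tau>")
          case False
          then have "0 < f \<tau> - y \<tau> $ i" using f_i[OF that, of \<tau>] by simp
          moreover have "(\<lambda>n. f (v (\<phi> n)) - y (v (\<phi> n)) $ i) \<longlonglongrightarrow> f \<tau> - y \<tau> $ i"
            by (intro tendsto_diff lf tendsto_vec_nth ly)
          ultimately have "\<forall>\<^sub>F n in sequentially. 0 < f (v (\<phi> n)) - y (v (\<phi> n)) $ i"
            by (rule order_tendstoD(1)[rotated])
          then show ?thesis by (rule eventually_mono) simp
        next
          case True
          then have "velocity w $ i < e" using top[OF that] \<open>0 < e\<close> by simp
          with tendsto_vec_nth[OF lw, of i]
          have "\<forall>\<^sub>F n in sequentially. ((y (v (\<phi> n)) - y (u (\<phi> n))) /\<^sub>R (v (\<phi> n) - u (\<phi> n))) $ i < e"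
            by (rule order_tendstoD(2))
          then show ?thesis
          proof (rule eventually_mono)
            fix n assume n: "((y (v (\<phi> n)) - y (u (\<phi> n))) /\<^sub>R (v (\<phi> n) - u (\<phi> n))) $ i < e"
            have "y (v (\<phi> n)) $ i - y (u (\<phi> n)) $ i < e * (v (\<phi> n) - u (\<phi> n))"
              using n less[of "\<phi> n"] pos_divide_less_eq[of "v (\<phi> n) - u (\<phi> n)" "y (v (\<phi> n)) $ i - y (u (\<phi> n)) $ i" e]
              by (simp add: divide_inverse mult.commute)
            then show "f (v (\<phi> n)) \<noteq> y (v (\<phi> n)) $ i \<or> f (v (\<phi> n)) - f (u (\<phi> n)) \<le> e * (v (\<phi> n) - u (\<phi> n))"
              using f_i[OF that, of "u (\<phi> n)"] by linarith
          qed
        qed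
        then have "\<forall>\<^sub>F n in sequentially. \<forall>i\<in>I. f (v (\<phi> n)) \<noteq> y (v (\<phi> n)) $ i \<or>
            f (v (\<phi> n)) - f (u (\<phi> n)) \<le> e * (v (\<phi> n) - u (\<phi> n))"
          by (intro eventually_ball_finite) auto
        then obtain n where n: "\<And>i. i \<in> I \<Longrightarrow> f (v (\<phi> n)) \<noteq> y (v (\<phi> n)) $ i \<or>
            f (v (\<phi> n)) - f (u (\<phi> n)) \<le> e * (v (\<phi> n) - u (\<phi> n))"
          unfolding eventually_sequentially by blast
        have "0 < e * (v (\<phi> n) - u (\<phi> n))" using \<open>0 < e\<close> less[of "\<phi> n"] by simp
        then have "f (v (\<phi> n)) \<noteq> c" using uv(6)[of "\<phi> n"] f_c[of "u (\<phi> n)"] by linarith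
        then obtain i where "i \<in> I" "f (v (\<phi> n)) = y (v (\<phi> n)) $ i" using f_cases by blast
        then show False using n[of i] uv(6)[of "\<phi> n"] by simp
      qed
    qed
  qed
  moreover have "f s \<le> m0" using f_cases[of s] m0 by auto
  ultimately show ?thesis using f_i[OF \<open>i0 \<in> I\<close>, of t] by simp
qed

section \<open>Limits of trajectories\<close>

definition largest :: "real^'n \<Rightarrow> real" where
  "largest p = Max (range (\<lambda>i. p $ i))"

lemma largest_ge: "p $ i \<le> largest p"
  by (simp add: largest_def)

lemma largest_attained: "\<exists>i. p $ i = largest p"
proof -
  have "largest p \<in> range (\<lambda>i. p $ i)" unfolding largest_def by (rule Max_in) auto
  then show ?thesis by auto
qed

lemma continuous_largest: "continuous_on UNIV largest"
proof -
  have *: "largest p \<le> largest q + norm (p - q)" for p q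
  proof -
    obtain i where "p $ i = largest p" using largest_attained by blast
    then show ?thesis
      using largest_ge[of q i] component_le_norm_cart[of "p - q" i] by (simp add: abs_le_iff)
  qed
  have "1-lipschitz_on UNIV largest"
  proof (rule lipschitz_onI)
    show "dist (largest p) (largest q) \<le> 1 * dist p q" for p q
      using *[of p q] *[of q p] unfolding dist_norm norm_minus_commute[of q p] real_norm_def by linarith
  qed simp
  then show ?thesis by (rule lipschitz_on_continuous_on)
qed

text \<open>
  Set-valued quantization is monotone only between distinct positions, so among the nodes at the largest position
  one with the largest value has to be chosen.
\<close>

lemma largest_value_attained:
  assumes "w \<in> qvals p"
  obtains k where "p $ k = largest p" "\<And>j. w $ j \<le> w $ k"
proof -
  define K where "K = {k. p $ k = largest p}"
  have "finite K" "K \<noteq> {}" using largest_attained by (auto simp: K_def)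
  then have "Max ((\<lambda>k. w $ k) ` K) \<in> (\<lambda>k. w $ k) ` K" by (intro Max_in) auto
  then obtain k where k: "k \<in> K" "Max ((\<lambda>k. w $ k) ` K) = w $ k" by auto
  have "w $ j \<le> w $ k" for j
  proof (cases "j \<in> K")
    case True
    then show ?thesis unfolding k(2)[symmetric] using \<open>finite K\<close> by (intro Max_ge) auto
  next
    case False
    then have "p $ j < p $ k" using largest_ge[of p j] k(1) by (auto simp: K_def)
    then show ?thesis
      using assms by (intro quantizer_values_mono[OF \<Delta>_pos, of "p $ j" "p $ k"]) (auto simp: qvals_def)
  qed
  then show thesis using that k(1) by (auto simp: K_def)
qed

lemma velocity_nonpos_at_largest:
  assumes "\<And>j. w $ j \<le> w $ k"
  shows "velocity w $ k \<le> 0"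
  unfolding velocity_nth by (intro sum_nonpos mult_nonneg_nonpos nonneg) (simp add: assms)

text \<open>
  A weighted sum of nonpositive differences \<open>w\<^sub>j - w\<^sub>k\<close> vanishes only if every in-neighbour of \<open>k\<close> has the same
  value. This is how information travels backwards along edges to the root.
\<close>

lemma velocity_zero_at_largest:
  assumes le: "\<And>j. w $ j \<le> w $ k" and zero: "velocity w $ k = 0" and "0 < A $ k $ j"
  shows "w $ j = w $ k"
proof -
  have "(\<Sum>j\<in>UNIV. A $ k $ j * (w $ k - w $ j)) = - (velocity w $ k)"
    unfolding velocity_nth sum_negf[symmetric] by (intro sum.cong) (auto simp: algebra_simps)
  then have "(\<Sum>j\<in>UNIV. A $ k $ j * (w $ k - w $ j)) = 0" using zero by simp
  moreover have "\<And>j. 0 \<le> A $ k $ j * (w $ k - w $ j)" using nonneg le by simp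
  ultimately have "A $ k $ j * (w $ k - w $ j) = 0" by (simp add: sum_nonneg_eq_0_iff)
  then show ?thesis using \<open>0 < A $ k $ j\<close> by simp
qed

lemma largest_nonincreasing:
  assumes y: "trajectory y" and st: "0 \<le> s" "s \<le> t"
  shows "largest (y t) \<le> largest (y s)"
proof -
  obtain i where i: "y t $ i = largest (y t)" using largest_attained by blast
  have "y t $ i \<le> largest (y s)"
  proof (rule level_not_crossed[OF y, where C = "{largest (y s)}" and c = "largest (y s)" and I = UNIV and s = s])
    fix \<tau> w m
    assume w: "admissible {largest (y s)} (y \<tau>) w" and m: "\<And>i. i \<in> UNIV \<Longrightarrow> y \<tau> $ i \<le> m" "\<exists>i\<in>UNIV. y \<tau> $ i = m"
    have "m = largest (y \<tau>)"
    proof (rule antisym)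
      show "m \<le> largest (y \<tau>)" using m(2) largest_ge by blast
      show "largest (y \<tau>) \<le> m" using m(1) largest_attained[of "y \<tau>"] by (metis UNIV_I)
    qed
    moreover have "w \<in> qvals (y \<tau>)" using w by (simp add: admissible_def)
    from largest_value_attained[OF this]
    obtain k where "y \<tau> $ k = largest (y \<tau>)" "\<And>j. w $ j \<le> w $ k" by blast
    ultimately show "\<exists>k\<in>UNIV. y \<tau> $ k = m \<and> velocity w $ k \<le> 0" using velocity_nonpos_at_largest by blast
  qed (use st largest_ge in auto)
  then show ?thesis using i by simp
qed

lemma trajectory_bounded:
  assumes y: "trajectory y"
  obtains R where "\<And>t. 0 \<le> t \<Longrightarrow> norm (y t) \<le> R"
proof -
  define R where "R = \<bar>largest (y 0)\<bar> + \<bar>largest (- y 0)\<bar>"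
  have "norm (y t) \<le> real CARD('n) * R" if "0 \<le> t" for t
  proof -
    have "\<bar>y t $ i\<bar> \<le> R" for i
    proof -
      have "y t $ i \<le> largest (y 0)"
        using largest_ge[of "y t" i] largest_nonincreasing[OF y, of 0 t] that by simp
      moreover have "- (y t $ i) \<le> largest (- y 0)"
        using largest_ge[of "- y t" i] largest_nonincreasing[OF trajectory_uminus[OF y], of 0 t] that by simp
      ultimately show ?thesis unfolding R_def by linarith
    qed
    then have "(\<Sum>i\<in>UNIV. \<bar>y t $ i\<bar>) \<le> (\<Sum>i\<in>(UNIV::'n set). R)" by (intro sum_mono)
    then show ?thesis using norm_le_l1_cart[of "y t"] by simp
  qed
  then show thesis by (rule that)
qed

text \<open>
  What is needed of an omega-limit trajectory: a continuous observable that converges along \<open>y\<close> is constant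
  along \<open>z\<close>. Quantifying over all observables lets the mirrored argument use the same limit.
\<close>

definition limit_of :: "(real \<Rightarrow> real^'n) \<Rightarrow> (real \<Rightarrow> real^'n) \<Rightarrow> bool" where
  "limit_of y z \<longleftrightarrow> trajectory z \<and>
     (\<forall>\<phi> :: real^'n \<Rightarrow> real. \<forall>l. continuous_on UNIV \<phi> \<longrightarrow> ((\<lambda>t. \<phi> (y t)) \<longlongrightarrow> l) at_top \<longrightarrow> (\<forall>s\<ge>0. \<phi> (z s) = l))"

lemma limit_of_trajectory: "limit_of y z \<Longrightarrow> trajectory z"
  by (simp add: limit_of_def)

lemma limit_ofD:
  fixes \<phi> :: "real^'n \<Rightarrow> real"
  shows "limit_of y z \<Longrightarrow> continuous_on UNIV \<phi> \<Longrightarrow> ((\<lambda>t. \<phi> (y t)) \<longlongrightarrow> l) at_top \<Longrightarrow> 0 \<le> s \<Longrightarrow> \<phi> (z s) = l"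
  unfolding limit_of_def by blast

lemma limit_of_constant:
  fixes \<phi> :: "real^'n \<Rightarrow> real"
  assumes "limit_of y z" "continuous_on UNIV \<phi>" "\<And>t. 0 \<le> t \<Longrightarrow> \<phi> (y t) = l" "0 \<le> s"
  shows "\<phi> (z s) = l"
proof (rule limit_ofD[OF assms(1,2) _ assms(4)])
  show "((\<lambda>t. \<phi> (y t)) \<longlongrightarrow> l) at_top"
    by (rule tendsto_eventually) (use assms(3) in \<open>auto simp: eventually_at_top_linorder\<close>)
qed

lemma limit_of_nonincreasing:
  fixes \<phi> :: "real^'n \<Rightarrow> real"
  assumes "limit_of y z" "continuous_on UNIV \<phi>"
    and "\<And>s t. 0 \<le> s \<Longrightarrow> s \<le> t \<Longrightarrow> \<phi> (y t) \<le> \<phi> (y s)" "\<And>t. 0 \<le> t \<Longrightarrow> b \<le> \<phi> (y t)"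
  obtains l where "\<And>s. 0 \<le> s \<Longrightarrow> \<phi> (z s) = l"
proof -
  obtain l where l: "((\<lambda>t. \<phi> (y t)) \<longlongrightarrow> l) at_top"
  proof (rule nonincreasing_tendsto_at_top[of "\<lambda>t. \<phi> (y t)" b])
    show "\<phi> (y t) \<le> \<phi> (y s)" if "0 \<le> s" "s \<le> t" for s t by (rule assms(3)[OF that])
    show "b \<le> \<phi> (y t)" if "0 \<le> t" for t by (rule assms(4)[OF that])
  qed (rule that)
  show thesis
  proof (rule that)
    show "\<phi> (z s) = l" if "0 \<le> s" for s using limit_ofD[OF assms(1,2) l that] .
  qed
qed

lemma limit_of_uminus:
  assumes "limit_of y z"
  shows "limit_of (\<lambda>t. - y t) (\<lambda>t. - z t)"
  unfolding limit_of_def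
proof (intro conjI allI impI)
  show "trajectory (\<lambda>t. - z t)" using limit_of_trajectory[OF assms] by (rule trajectory_uminus)
  fix \<phi> :: "real^'n \<Rightarrow> real" and l s
  assume \<phi>: "continuous_on UNIV \<phi>" "((\<lambda>t. \<phi> (- y t)) \<longlongrightarrow> l) at_top" and "0 \<le> (s :: real)"
  have "continuous_on UNIV (\<lambda>p. \<phi> (- p))"
    by (rule continuous_on_compose2[OF \<phi>(1)]) (auto intro: continuous_intros)
  from limit_ofD[OF assms this \<phi>(2) \<open>0 \<le> s\<close>] show "\<phi> (- z s) = l" .
qed

lemma limit_of_exists:
  assumes y: "trajectory y"
  obtains z where "limit_of y z"
proof -
  obtain R where R: "\<And>t. 0 \<le> t \<Longrightarrow> norm (y t) \<le> R" using trajectory_bounded[OF y] by blast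
  obtain \<kappa> z where \<kappa>: "strict_mono (\<kappa> :: nat \<Rightarrow> nat)" and "trajectory z"
    and z: "\<And>s. 0 \<le> s \<Longrightarrow> (\<lambda>n. y (real (\<kappa> n) + s)) \<longlonglongrightarrow> z s"
    using limit_trajectory[OF y R] by blast
  have "\<phi> (z s) = l" if \<phi>: "continuous_on UNIV \<phi>" and l: "((\<lambda>t. \<phi> (y t)) \<longlongrightarrow> l) at_top" and "0 \<le> s"
    for \<phi> :: "real^'n \<Rightarrow> real" and l s
  proof (rule LIMSEQ_unique)
    show "(\<lambda>n. \<phi> (y (real (\<kappa> n) + s))) \<longlonglongrightarrow> \<phi> (z s)"
      by (rule continuous_on_tendsto_compose[OF \<phi> z[OF \<open>0 \<le> s\<close>]]) auto
    have "filterlim (\<lambda>n. real (\<kappa> n)) at_top sequentially"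
      by (rule filterlim_compose[OF filterlim_real_sequentially filterlim_subseq[OF \<kappa>]])
    then have "filterlim (\<lambda>n. s + real (\<kappa> n)) at_top sequentially"
      by (rule filterlim_tendsto_add_at_top[OF tendsto_const])
    then have "filterlim (\<lambda>n. real (\<kappa> n) + s) at_top sequentially" by (simp only: add.commute)
    then show "(\<lambda>n. \<phi> (y (real (\<kappa> n) + s))) \<longlonglongrightarrow> l" by (rule filterlim_compose[OF l])
  qed
  then show thesis using that \<open>trajectory z\<close> unfolding limit_of_def by blast
qed

section \<open>Levels of the limits\<close>

lemma truncation_nonincreasing:
  assumes y: "trajectory y" and C: "finite C" "b \<in> C"
    and v: "\<And>t w. 0 \<le> t \<Longrightarrow> admissible C (y t) w \<Longrightarrow> b < y t $ i \<Longrightarrow> velocity w $ i \<le> 0"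
    and st: "0 \<le> s" "s \<le> t"
  shows "max (y t $ i) b \<le> max (y s $ i) b"
proof -
  have "y t $ i \<le> max (y s $ i) b"
    by (rule level_not_crossed[OF y C, where I = "{i}" and s = s]) (use v st in auto)
  then show ?thesis by simp
qed

lemma continuous_truncation: "continuous_on UNIV (\<lambda>p :: real^'n. max (p $ i) b)"
  by (intro continuous_intros)

lemma value_above_level:
  fixes l :: int
  assumes "w \<in> qvals p" "(of_int l - 1 / 2) * \<Delta> < p $ i"
  shows "of_int l * \<Delta> \<le> w $ i"
  using assms by (intro quantizer_values_lower) (auto simp: qvals_def)

lemma velocity_nonpos_above_level:
  fixes l :: int
  assumes w: "admissible C p w" and le: "\<forall>j. w $ j \<le> of_int l * \<Delta>" and i: "(of_int l - 1 / 2) * \<Delta> < p $ i"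
  shows "velocity w $ i \<le> 0"
proof (rule velocity_nonpos_at_largest)
  have "of_int l * \<Delta> \<le> w $ i" using w i by (intro value_above_level) (auto simp: admissible_def)
  then show "w $ j \<le> w $ i" for j using le by (meson order_trans)
qed

context
  fixes l :: int and M :: real
  assumes lM: "(of_int l - 1 / 2) * \<Delta> < M" and Ml: "M \<le> (of_int l + 1 / 2) * \<Delta>"
begin

text \<open>
  If some value exceeds \<open>l \<Delta>\<close>, then a node with the largest value is not below the upper border of the cell, hence
  at \<open>M\<close> and at rest. By \<open>velocity_zero_at_largest\<close> the set of these nodes is not entered from outside, so
  it contains the root.
\<close>

lemma root_at_top_or_values_bounded:
  assumes M: "largest p = M" "M \<in> C" and w: "admissible C p w"
  shows "p $ r = M \<or> (\<forall>j. w $ j \<le> of_int l * \<Delta>)"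
proof (rule disjCI)
  assume "\<not> (\<forall>j. w $ j \<le> of_int l * \<Delta>)"
  then obtain j where j: "of_int l * \<Delta> < w $ j" by (auto simp: not_le)
  have wp: "w \<in> qvals p" using w by (simp add: admissible_def)
  from largest_value_attained[OF this]
  obtain k where k: "p $ k = largest p" "\<And>j. w $ j \<le> w $ k" by blast
  define Z where "Z = {i. w $ i = w $ k}"
  have pZ: "p $ i = M" if "i \<in> Z" for i
  proof -
    have "\<not> p $ i < (of_int l + 1 / 2) * \<Delta>"
    proof
      assume "p $ i < (of_int l + 1 / 2) * \<Delta>"
      then have "w $ i \<le> of_int l * \<Delta>" using wp by (intro quantizer_values_upper) (auto simp: qvals_def)
      then show False using j k(2)[of j] that by (simp add: Z_def)
    qed
    then show ?thesis using Ml M(1) largest_ge[of p i] by simp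
  qed
  have "r \<in> Z"
  proof (rule root)
    show "Z \<noteq> {}" by (auto simp: Z_def)
    fix i j assume "i \<in> Z" "0 < A $ i $ j"
    have "velocity w $ i = 0" using w pZ[OF \<open>i \<in> Z\<close>] M(2) unfolding admissible_def by blast
    moreover have "\<And>j. w $ j \<le> w $ i" using k(2) \<open>i \<in> Z\<close> by (simp add: Z_def)
    ultimately have "w $ j = w $ i" using \<open>0 < A $ i $ j\<close> by (intro velocity_zero_at_largest) auto
    then show "j \<in> Z" using \<open>i \<in> Z\<close> by (simp add: Z_def)
  qed
  then show "p $ r = M" by (rule pZ)
qed

lemma root_truncation_nonincreasing:
  assumes y: "trajectory y" and M: "\<And>t. 0 \<le> t \<Longrightarrow> largest (y t) = M" and st: "0 \<le> s" "s \<le> t"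
  shows "max (y t $ r) ((of_int l - 1 / 2) * \<Delta>) \<le> max (y s $ r) ((of_int l - 1 / 2) * \<Delta>)"
proof (rule truncation_nonincreasing[OF y, where C = "{(of_int l - 1 / 2) * \<Delta>, M}"])
  fix t w assume "0 \<le> t" and w: "admissible {(of_int l - 1 / 2) * \<Delta>, M} (y t) w"
    and i: "(of_int l - 1 / 2) * \<Delta> < y t $ r"
  from root_at_top_or_values_bounded[OF M[OF \<open>0 \<le> t\<close>] _ w]
  consider "y t $ r = M" | "\<forall>j. w $ j \<le> of_int l * \<Delta>" by auto
  then show "velocity w $ r \<le> 0"
  proof cases
    case 1
    then have "velocity w $ r = 0" using w unfolding admissible_def by blast
    then show ?thesis by simp
  next
    case 2
    then show ?thesis using velocity_nonpos_above_level[OF w _ i] by blast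
  qed
qed (use st in auto)

text \<open>
  A truncated root position that is constant and different from \<open>M\<close> keeps the root away from \<open>M\<close>; all values
  are then at most \<open>l \<Delta>\<close>, and no node above the threshold can move up.
\<close>

lemma truncations_nonincreasing:
  assumes y: "trajectory y" and M: "\<And>t. 0 \<le> t \<Longrightarrow> largest (y t) = M"
    and c: "\<And>t. 0 \<le> t \<Longrightarrow> max (y t $ r) ((of_int l - 1 / 2) * \<Delta>) = c" "c \<noteq> M"
    and st: "0 \<le> s" "s \<le> t"
  shows "max (y t $ i) ((of_int l - 1 / 2) * \<Delta>) \<le> max (y s $ i) ((of_int l - 1 / 2) * \<Delta>)"
proof (rule truncation_nonincreasing[OF y, where C = "{(of_int l - 1 / 2) * \<Delta>, M}"])
  fix t w assume "0 \<le> t" and w: "admissible {(of_int l - 1 / 2) * \<Delta>, M} (y t) w"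
    and i: "(of_int l - 1 / 2) * \<Delta> < y t $ i"
  have "y t $ r \<noteq> M" using c(1)[OF \<open>0 \<le> t\<close>] c(2) lM by auto
  then have "\<forall>j. w $ j \<le> of_int l * \<Delta>"
    using root_at_top_or_values_bounded[OF M[OF \<open>0 \<le> t\<close>] _ w] by auto
  then show "velocity w $ i \<le> 0" using velocity_nonpos_above_level[OF w _ i] by blast
qed (use st in auto)

text \<open>
  If the root is not at \<open>M\<close>, no value exceeds \<open>l \<Delta>\<close>. Nodes with value \<open>l \<Delta>\<close> are not below the threshold, so
  their constant truncated position is their position; hence they are at rest, and their in-neighbours have value
  \<open>l \<Delta>\<close> as well.
\<close>

lemma root_value_above_level:
  assumes M: "\<And>t. 0 \<le> t \<Longrightarrow> largest (y t) = M"
    and c: "\<And>t. 0 \<le> t \<Longrightarrow> max (y t $ r) ((of_int l - 1 / 2) * \<Delta>) = c"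
    and d: "c \<noteq> M \<Longrightarrow> \<exists>d. \<forall>i. \<forall>t\<ge>0. max (y t $ i) ((of_int l - 1 / 2) * \<Delta>) = d i"
  obtains C where "finite C" "\<And>t w. 0 \<le> t \<Longrightarrow> admissible C (y t) w \<Longrightarrow> of_int l * \<Delta> \<le> w $ r"
proof (cases "c = M")
  case True
  have "of_int l * \<Delta> \<le> w $ r" if "0 \<le> t" "admissible {} (y t) w" for t w
  proof (rule value_above_level)
    show "w \<in> qvals (y t)" using that by (simp add: admissible_def)
    show "(of_int l - 1 / 2) * \<Delta> < y t $ r" using c[OF that(1)] True lM by (auto simp: max_def split: if_splits)
  qed
  then show ?thesis using that[of "{}"] by blast
next
  case False
  then obtain d where d: "\<And>i t. 0 \<le> t \<Longrightarrow> max (y t $ i) ((of_int l - 1 / 2) * \<Delta>) = d i" using d by blast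
  have "of_int l * \<Delta> \<le> w $ r" if "0 \<le> t" and w: "admissible (insert M (range d)) (y t) w" for t w
  proof -
    have wp: "w \<in> qvals (y t)" using w by (simp add: admissible_def)
    have "y t $ r \<noteq> M" using c[OF \<open>0 \<le> t\<close>] False lM by auto
    then have le: "\<And>j. w $ j \<le> of_int l * \<Delta>"
      using root_at_top_or_values_bounded[OF M[OF \<open>0 \<le> t\<close>] _ w] by auto
    define Z where "Z = {i. w $ i = of_int l * \<Delta>}"
    have "r \<in> Z"
    proof (rule root)
      obtain k where "y t $ k = M" using largest_attained[of "y t"] M[OF \<open>0 \<le> t\<close>] by auto
      then have "of_int l * \<Delta> \<le> w $ k" using lM by (intro value_above_level[OF wp]) simp
      then have "k \<in> Z" using le[of k] by (simp add: Z_def)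
      then show "Z \<noteq> {}" by blast
      fix i j assume i: "i \<in> Z" and "0 < A $ i $ j"
      have "\<not> y t $ i < (of_int l - 1 / 2) * \<Delta>"
      proof
        assume "y t $ i < (of_int l - 1 / 2) * \<Delta>"
        then have "y t $ i < (of_int (l - 1) + 1 / 2) * \<Delta>" by simp
        then have "w $ i \<le> of_int (l - 1) * \<Delta>" using wp by (intro quantizer_values_upper) (auto simp: qvals_def)
        then show False using i \<Delta>_pos by (simp add: Z_def algebra_simps)
      qed
      \<comment> \<open>The position of \<open>i\<close> is thus one of the distinguished levels.\<close>
      then have "y t $ i = d i" using d[OF \<open>0 \<le> t\<close>, of i] by simp
      then have "velocity w $ i = 0" using w unfolding admissible_def by blast
      moreover have "\<And>j. w $ j \<le> w $ i" using le i by (simp add: Z_def)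
      ultimately have "w $ j = w $ i" using \<open>0 < A $ i $ j\<close> by (intro velocity_zero_at_largest) auto
      then show "j \<in> Z" using i by (simp add: Z_def)
    qed
    then show ?thesis by (simp add: Z_def)
  qed
  then show ?thesis using that[of "insert M (range d)"] by auto
qed

text \<open>
  Each limit turns the monotone quantities of the previous one into constants: first the largest
  coordinate, then the truncated root position, then, unless the root stays at \<open>M\<close>, all truncated positions.
\<close>

lemma iterated_limit_root_value:
  assumes lim: "((\<lambda>t. largest (x t)) \<longlongrightarrow> M) at_top" and xy: "limit_of x y" and yz: "limit_of y z" and zu: "limit_of z u"
  obtains C where "finite C" "\<And>t w. 0 \<le> t \<Longrightarrow> admissible C (u t) w \<Longrightarrow> of_int l * \<Delta> \<le> w $ r"
proof -
  let ?b = "(of_int l - 1 / 2) * \<Delta>"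
  note traj = limit_of_trajectory[OF xy] limit_of_trajectory[OF yz] limit_of_trajectory[OF zu]
  have My: "largest (y t) = M" if "0 \<le> t" for t using limit_ofD[OF xy continuous_largest lim that] .
  have Mz: "largest (z t) = M" if "0 \<le> t" for t using limit_of_constant[OF yz continuous_largest My that] .
  have Mu: "largest (u t) = M" if "0 \<le> t" for t using limit_of_constant[OF zu continuous_largest Mz that] .
  obtain c where cz: "\<And>t. 0 \<le> t \<Longrightarrow> max (z t $ r) ?b = c"
  proof (rule limit_of_nonincreasing[OF yz continuous_truncation[of r ?b]])
    show "max (y t $ r) ?b \<le> max (y s $ r) ?b" if "0 \<le> s" "s \<le> t" for s t
      using root_truncation_nonincreasing[OF traj(1) My that] .
    show "?b \<le> max (y t $ r) ?b" for t by simp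
  qed (rule that)
  have cu: "max (u t $ r) ?b = c" if "0 \<le> t" for t
    using limit_of_constant[OF zu continuous_truncation[of r ?b] cz that] .
  have d: "\<exists>d. \<forall>i. \<forall>t\<ge>0. max (u t $ i) ?b = d i" if "c \<noteq> M"
  proof -
    have "\<exists>e. \<forall>t\<ge>0. max (u t $ i) ?b = e" for i
    proof -
      obtain e where "\<And>t. 0 \<le> t \<Longrightarrow> max (u t $ i) ?b = e"
      proof (rule limit_of_nonincreasing[OF zu continuous_truncation[of i ?b]])
        show "max (z t $ i) ?b \<le> max (z s $ i) ?b" if "0 \<le> s" "s \<le> t" for s t
          using truncations_nonincreasing[OF traj(2) Mz cz \<open>c \<noteq> M\<close> that] .
        show "?b \<le> max (z t $ i) ?b" for t by simp
      qed (rule that)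
      then show ?thesis by blast
    qed
    then show ?thesis by metis
  qed
  show thesis using root_value_above_level[OF Mu cu d] that by blast
qed

end

section \<open>Practical consensus\<close>

lemma admissible_mono: "admissible C p w \<Longrightarrow> C' \<subseteq> C \<Longrightarrow> admissible C' p w"
  unfolding admissible_def by blast

lemma admissible_uminus:
  assumes "admissible C p w"
  shows "admissible (uminus ` C) (- p) (- w)"
  unfolding admissible_def
proof (intro conjI allI impI)
  show "- w \<in> qvals (- p)" using assms by (intro qvals_uminus) (simp add: admissible_def)
  show "velocity (- w) $ i = velocity (- w) $ j" if "(- p) $ i = (- p) $ j" for i j
    using assms that unfolding admissible_def velocity_uminus vector_uminus_component neg_equal_iff_equal by blast
  fix i assume "(- p) $ i \<in> uminus ` C"
  then have "p $ i \<in> C" by auto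
  then have "velocity w $ i = 0" using assms unfolding admissible_def by blast
  then show "velocity (- w) $ i = 0" by (simp add: velocity_uminus)
qed

text \<open>
  The limits of the largest coordinate of \<open>x\<close> and of \<open>- x\<close> have levels \<open>l\<close> and \<open>l'\<close>. A single value
  \<open>w\<^sub>r\<close> with \<open>l \<Delta> \<le> w\<^sub>r\<close> and \<open>l' \<Delta> \<le> - w\<^sub>r\<close> shows \<open>l \<le> - l'\<close>.
\<close>

lemma limits_in_common_cell:
  assumes x: "trajectory x" and M: "((\<lambda>t. largest (x t)) \<longlongrightarrow> M) at_top" "((\<lambda>t. largest (- x t)) \<longlongrightarrow> M') at_top"
  obtains k :: int where "(of_int k - 1 / 2) * \<Delta> \<le> - M'" "M \<le> (of_int k + 1 / 2) * \<Delta>"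
proof -
  have level: "(of_int \<lceil>m / \<Delta> - 1 / 2\<rceil> - 1 / 2) * \<Delta> < m" "m \<le> (of_int \<lceil>m / \<Delta> - 1 / 2\<rceil> + 1 / 2) * \<Delta>" for m
  proof -
    have "of_int \<lceil>m / \<Delta> - 1 / 2\<rceil> - 1 / 2 < m / \<Delta>" "m / \<Delta> \<le> of_int \<lceil>m / \<Delta> - 1 / 2\<rceil> + 1 / 2" by linarith+
    then show "(of_int \<lceil>m / \<Delta> - 1 / 2\<rceil> - 1 / 2) * \<Delta> < m" "m \<le> (of_int \<lceil>m / \<Delta> - 1 / 2\<rceil> + 1 / 2) * \<Delta>"
      using \<Delta>_pos by (simp_all only: pos_less_divide_eq pos_divide_le_eq)
  qed
  \<comment> \<open>Rounding up puts a limit on the border of two cells into the lower one, as the strict lower bound requires.\<close>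
  define l l' where "l = \<lceil>M / \<Delta> - 1 / 2\<rceil>" and "l' = \<lceil>M' / \<Delta> - 1 / 2\<rceil>"
  obtain y where xy: "limit_of x y" using limit_of_exists[OF x] .
  obtain z where yz: "limit_of y z" using limit_of_exists[OF limit_of_trajectory[OF xy]] .
  obtain u where zu: "limit_of z u" using limit_of_exists[OF limit_of_trajectory[OF yz]] .
  obtain C where C: "finite C" "\<And>t w. 0 \<le> t \<Longrightarrow> admissible C (u t) w \<Longrightarrow> of_int l * \<Delta> \<le> w $ r"
    using iterated_limit_root_value[OF level[of M] M(1) xy yz zu] unfolding l_def by blast
  obtain C' where C': "finite C'" "\<And>t w. 0 \<le> t \<Longrightarrow> admissible C' (- u t) w \<Longrightarrow> of_int l' * \<Delta> \<le> w $ r"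
    using iterated_limit_root_value[OF level[of M'] M(2) limit_of_uminus[OF xy] limit_of_uminus[OF yz] limit_of_uminus[OF zu]]
    unfolding l'_def by blast
  have "finite (C \<union> uminus ` C')" using C(1) C'(1) by simp
  with limit_of_trajectory[OF zu] obtain t w where "0 \<le> t" and w: "admissible (C \<union> uminus ` C') (u t) w"
    by (rule admissible_exists)
  have "of_int l * \<Delta> \<le> w $ r" using C(2)[OF \<open>0 \<le> t\<close> admissible_mono[OF w]] by simp
  moreover have "of_int l' * \<Delta> \<le> (- w) $ r"
  proof (rule C'(2)[OF \<open>0 \<le> t\<close> admissible_mono[OF admissible_uminus[OF w]]])
    show "C' \<subseteq> uminus ` (C \<union> uminus ` C')" by (auto simp: image_Un image_image)
  qed
  ultimately have "of_int l * \<Delta> + of_int l' * \<Delta> \<le> 0" by simp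
  then have "of_int (l + l') * \<Delta> \<le> 0" by (simp add: distrib_right)
  then have "l + l' \<le> 0" using \<Delta>_pos by (simp add: mult_le_0_iff)
  show thesis
  proof (rule that[of l])
    show "M \<le> (of_int l + 1 / 2) * \<Delta>" using level(2)[of M] by (simp add: l_def)
    have "(of_int l - 1 / 2) * \<Delta> \<le> - ((of_int l' + 1 / 2) * \<Delta>)"
    proof -
      have "real_of_int (l + l') * \<Delta> \<le> 0" by fact
      then show ?thesis by (simp add: algebra_simps)
    qed
    also have "\<dots> \<le> - M'" using level(2)[of M'] by (simp add: l'_def)
    finally show "(of_int l - 1 / 2) * \<Delta> \<le> - M'" .
  qed
qed

text \<open>
  Clipping the coordinates to the common cell moves each of them by no more than the amount by which the extreme
  coordinates still differ from their limits.
\<close>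

lemma trajectory_converges_to_practical_consensus:
  assumes x: "trajectory x"
  shows "converges_to_set x (practical_consensus \<Delta>)"
proof -
  have x': "trajectory (\<lambda>t. - x t)" using x by (rule trajectory_uminus)
  obtain R where R: "\<And>t. 0 \<le> t \<Longrightarrow> norm (x t) \<le> R" using trajectory_bounded[OF x] by blast
  have low: "- R \<le> largest (x t)" "- R \<le> largest (- x t)" if "0 \<le> t" for t
  proof -
    have "- R \<le> x t $ r" "- R \<le> - (x t $ r)"
      using R[OF that] component_le_norm_cart[of "x t" r] by (auto simp: abs_le_iff)
    then show "- R \<le> largest (x t)" "- R \<le> largest (- x t)"
      using largest_ge[of "x t" r] largest_ge[of "- x t" r] by auto
  qed
  obtain M where M: "((\<lambda>t. largest (x t)) \<longlongrightarrow> M) at_top" "\<And>t. 0 \<le> t \<Longrightarrow> M \<le> largest (x t)"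
    using nonincreasing_tendsto_at_top[of "\<lambda>t. largest (x t)" "- R"] largest_nonincreasing[OF x] low(1) by blast
  obtain M' where M': "((\<lambda>t. largest (- x t)) \<longlongrightarrow> M') at_top" "\<And>t. 0 \<le> t \<Longrightarrow> M' \<le> largest (- x t)"
    using nonincreasing_tendsto_at_top[of "\<lambda>t. largest (- x t)" "- R"] largest_nonincreasing[OF x'] low(2) by blast
  obtain k :: int where k: "(of_int k - 1 / 2) * \<Delta> \<le> - M'" "M \<le> (of_int k + 1 / 2) * \<Delta>"
    using limits_in_common_cell[OF x M(1) M'(1)] .
  define a b where "a = (of_int k - 1 / 2) * \<Delta>" and "b = (of_int k + 1 / 2) * \<Delta>"
  have "a \<le> b" using \<Delta>_pos by (simp add: a_def b_def)
  define P where "P p = (\<chi> i. max a (min b (p $ i)))" for p :: "real^'n"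
  have P: "P p \<in> practical_consensus \<Delta>" for p
    unfolding practical_consensus_def using \<open>a \<le> b\<close> by (auto simp: P_def a_def[symmetric] b_def[symmetric] intro!: exI[of _ k])
  have bound: "infdist (x t) (practical_consensus \<Delta>) \<le> real CARD('n) * ((largest (x t) - M) + (largest (- x t) - M'))"
    if "0 \<le> t" for t
  proof -
    have "infdist (x t) (practical_consensus \<Delta>) \<le> dist (x t) (P (x t))" using P by (rule infdist_le)
    also have "\<dots> \<le> (\<Sum>i\<in>UNIV. \<bar>(x t - P (x t)) $ i\<bar>)" unfolding dist_norm by (rule norm_le_l1_cart)
    also have "\<dots> \<le> (\<Sum>i\<in>(UNIV::'n set). (largest (x t) - M) + (largest (- x t) - M'))"
    proof (rule sum_mono)
      fix i
      have "x t $ i - b \<le> largest (x t) - M" using largest_ge[of "x t" i] k(2) by (simp add: b_def)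
      moreover have "a - x t $ i \<le> largest (- x t) - M'" using largest_ge[of "- x t" i] k(1) by (simp add: a_def)
      moreover have "(x t - P (x t)) $ i = x t $ i - max a (min b (x t $ i))" by (simp add: P_def)
      ultimately show "\<bar>(x t - P (x t)) $ i\<bar> \<le> (largest (x t) - M) + (largest (- x t) - M')"
        using M(2)[OF that] M'(2)[OF that] \<open>a \<le> b\<close> by (auto simp: max_def min_def)
    qed
    finally show ?thesis by simp
  qed
  have "((\<lambda>t. real CARD('n) * ((largest (x t) - M) + (largest (- x t) - M'))) \<longlongrightarrow> real CARD('n) * ((M - M) + (M' - M'))) at_top"
    by (intro tendsto_intros M(1) M'(1))
  then have lim: "((\<lambda>t. real CARD('n) * ((largest (x t) - M) + (largest (- x t) - M'))) \<longlongrightarrow> 0) at_top" by simp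
  have "((\<lambda>t. infdist (x t) (practical_consensus \<Delta>)) \<longlongrightarrow> 0) at_top"
  proof (rule tendsto_sandwich[OF _ _ tendsto_const lim])
    show "\<forall>\<^sub>F t in at_top. 0 \<le> infdist (x t) (practical_consensus \<Delta>)" by (simp add: infdist_nonneg)
    show "\<forall>\<^sub>F t in at_top. infdist (x t) (practical_consensus \<Delta>) \<le> real CARD('n) * ((largest (x t) - M) + (largest (- x t) - M'))"
      using eventually_ge_at_top[of 0] by (rule eventually_mono) (rule bound)
  qed
  moreover have "practical_consensus \<Delta> \<noteq> ({} :: (real^'n) set)" using P by blast
  ultimately show ?thesis by (simp add: converges_to_set_def)
qed

end

theorem corollary4p1:
  fixes E :: "('n::finite \<times> 'n) set" and A :: "real^'n^'n"
    and \<Delta> :: real and x :: "real \<Rightarrow> real^'n"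
  assumes "weighted_digraph E A"
    and "\<exists>T. directed_spanning_tree T (digraph_of E)"
    and "0 < \<Delta>"
    and "complete_filippov_solution (\<lambda>y. - (laplacian A *v sym_quantizer_vec \<Delta> y)) x"
  shows "converges_to_set x (practical_consensus \<Delta>)"
proof -
  obtain T where T: "directed_spanning_tree T (digraph_of E)" using assms(2) by blast
  obtain r where r: "\<And>Z. Z \<noteq> {} \<Longrightarrow> (\<And>k j. k \<in> Z \<Longrightarrow> 0 < A $ k $ j \<Longrightarrow> j \<in> Z) \<Longrightarrow> r \<in> Z"
    using spanning_tree_root[OF assms(1) T] by blast
  interpret quantized_consensus A \<Delta> r
    using assms(1,3) r by unfold_locales (auto simp: weighted_digraph_def)
  show ?thesis
    using assms(4) by (intro trajectory_converges_to_practical_consensus filippov_solution_imp_trajectory)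
qed

end
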